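(* Let $G\subset GL(n,\mathbb{R})$ be a matrix Lie group with Lie algebra of dimension $d$, and let $f_{u_t}$ define an affine group system on $G$, i.e. $f_{u_t}(XY)=f_{u_t}(X)Y+Xf_{u_t}(Y)-Xf_{u_t}(I)Y$ for all $u_t\in\mathcal U$, $X,Y\in G$. Let $w_t\in\mathbb{R}^d$ be a differentiable disturbance, and let $X_t,\hat X_t\in G$ satisfy $\dot X_t=f_{u_t}(X_t)+X_tw_t^\wedge$ and $\dot{\hat X}_t=f_{u_t}(\hat X_t)$ (possibly with different initial states). Define the left- and right-invariant errors $\eta^{\rm L}_t=\hat X_t^{-1}X_t$ (LIE) and $\eta^{\rm R}_t=X_t\hat X_t^{-1}$ (RIE), whose dynamics are $$\dot\eta^{\rm L}_t=f_{u_t}(\eta^{\rm L}_t)-f_{u_t}(I)\eta^{\rm L}_t+\eta^{\rm L}_tw_t^\wedge,\qquad \dot\eta^{\rm R}_t=f_{u_t}(\eta^{\rm R}_t)-\eta^{\rm R}_tf_{u_t}(I)+\eta^{\rm R}_t\,\mathrm{Ad}_{\hat X_t}w_t^\wedge,$$ and let $\xi^{\rm L}_t=\log_{\rm m}(\eta^{\rm L}_t)$, $\xi^{\rm R}_t=\log_{\rm m}(\eta^{\rm R}_t)$. Assume that $\mathrm{dexp_m}(-\xi_t)$ is invertible for $t\in[t_0,T)$, where $T\in(t_0,\infty]$ and $\xi_t$ stands for the error under consideration. Then $$\dot\xi^{\rm L}_t=\mathrm{dexp}_{\rm m}^{-1}(-\xi^{\rm L}_t)\,w_t+A_t\xi^{\rm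 L}_t\quad\text{(LIE)},$$ $$\dot\xi^{\rm R}_t=\mathrm{dexp}_{\rm m}^{-1}(-\xi^{\rm R}_t)\,\mathrm{Ad}_{\hat X_t}w_t+A_t\xi^{\rm R}_t\quad\text{(RIE)},$$ where $A_t$ is the differential at $x=0$ of the mapping $x\mapsto\big(\exp_{\rm m}(x)^{-1}g_{u_t}(\exp_{\rm m}(x))\big)^\vee$, with $g_{u_t}(\eta)=f_{u_t}(\eta)-f_{u_t}(I)\eta$ in the LIE case and $g_{u_t}(\eta)=f_{u_t}(\eta)-\eta f_{u_t}(I)$ in the RIE case.
   Context: A matrix Lie group is a closed subgroup $G$ of $GL(n,\mathbb{R})$, with Lie algebra $\mathfrak g$ of dimension $d$. A linear isomorphism $(\cdot)^\wedge:\mathbb{R}^d\to\mathfrak g$ is fixed, with inverse $(\cdot)^\vee$. $\exp_{\rm m}(x)=\exp(x^\wedge)$ for $x\in\mathbb{R}^d$; $\log_{\rm m}$ is the inverse of $\exp_{\rm m}$, defined within a neighborhood of the identity. $\mathrm{Ad}_Xy=XyX^{-1}$ for $X\in G$, $y\in\mathfrak g$; for $w\in\mathbb{R}^d$, $\mathrm{Ad}_Xw$ means $(Xw^\wedge X^{-1})^\vee$. For $x\in\mathbb{R}^d$, $\mathrm{adm}_x$ is the $d\times d$ matrix with $\mathrm{adm}_xy=[x^\wedge,y^\wedge]^\vee$, $\mathrm{dexp_m}(x)=\sum_{i=0}^\infty\frac{1}{(i+1)!}\mathrm{adm}_x^i$, and $\mathrm{dexp}_{\rm m}^{-1}(x)$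 is its matrix inverse. $f_{u_t}(X)\in T_XG$ for $X\in G$, where $u_t\in\mathcal U\subset\mathbb{R}^d$ is an input. *)

theory Defs
  imports "HOL-Analysis.Analysis"
begin

(* The type real ^ 'n ^ 'n multiplies componentwise under ( * ), so the library's power and exp
   do not apply to it. *)
primrec mat_pow :: "real ^ 'n ^ 'n \<Rightarrow> nat \<Rightarrow> real ^ 'n ^ 'n" where
  "mat_pow A 0 = mat 1"
| "mat_pow A (Suc k) = A ** mat_pow A k"

definition mat_exp :: "real ^ 'n ^ 'n \<Rightarrow> real ^ 'n ^ 'n" where
  "mat_exp A = (\<Sum>k. (1 / fact k) *\<^sub>R mat_pow A k)"

definition GL :: "(real ^ 'n ^ 'n) set" where
  "GL = {A. invertible A}"

definition matrix_lie_group :: "(real ^ 'n ^ 'n) set \<Rightarrow> bool" where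
  "matrix_lie_group G \<longleftrightarrow>
     closedin (top_of_set GL) G \<and> mat 1 \<in> G \<and>
     (\<forall>A\<in>G. \<forall>B\<in>G. A ** B \<in> G) \<and> (\<forall>A\<in>G. matrix_inv A \<in> G)"

definition tangent_space :: "(real ^ 'n ^ 'n) set \<Rightarrow> real ^ 'n ^ 'n \<Rightarrow> (real ^ 'n ^ 'n) set" where
  "tangent_space G X = {v. \<exists>\<gamma> \<epsilon>. \<epsilon> > 0 \<and>
     (\<forall>s\<in>{-\<epsilon><..<\<epsilon>}. \<gamma> s \<in> G \<and> \<gamma> differentiable (at s)) \<and>
     \<gamma> 0 = X \<and> (\<gamma> has_vector_derivative v) (at 0)}"

definition lie_algebra :: "(real ^ 'n ^ 'n) set \<Rightarrow> (real ^ 'n ^ 'n) set" where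
  "lie_algebra G = tangent_space G (mat 1)"

definition bracket :: "real ^ 'n ^ 'n \<Rightarrow> real ^ 'n ^ 'n \<Rightarrow> real ^ 'n ^ 'n" where
  "bracket A B = A ** B - B ** A"

definition lie_algebra_iso ::
    "(real ^ 'n ^ 'n) set \<Rightarrow> (real ^ 'd \<Rightarrow> real ^ 'n ^ 'n) \<Rightarrow> bool" where
  "lie_algebra_iso G hat \<longleftrightarrow> linear hat \<and> bij_betw hat UNIV (lie_algebra G)"

(* The inverse of hat; meaningful only on the range of hat, i.e. on the Lie algebra. *)
definition vee :: "(real ^ 'd \<Rightarrow> real ^ 'n ^ 'n) \<Rightarrow> real ^ 'n ^ 'n \<Rightarrow> real ^ 'd" where
  "vee hat = inv hat"

definition expm :: "(real ^ 'd \<Rightarrow> real ^ 'n ^ 'n) \<Rightarrow> real ^ 'd \<Rightarrow> real ^ 'n ^ 'n" where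
  "expm hat x = mat_exp (hat x)"

(* logm is an inverse of expm, defined on a neighbourhood V of the identity in G and with values
   in a neighbourhood W of 0. Continuity of logm is not imposed. Openness of W is essential: it
   excludes branches with a cut inside V, such as angles in the half-open interval from -pi to pi
   for SO(2). *)
definition local_log ::
    "(real ^ 'n ^ 'n) set \<Rightarrow> (real ^ 'd \<Rightarrow> real ^ 'n ^ 'n) \<Rightarrow> (real ^ 'n ^ 'n) set \<Rightarrow>
     (real ^ 'n ^ 'n \<Rightarrow> real ^ 'd) \<Rightarrow> bool" where
  "local_log G hat V logm \<longleftrightarrow>
     openin (top_of_set G) V \<and> mat 1 \<in> V \<and>
     (\<exists>W. open W \<and> 0 \<in> W \<and>
       (\<forall>x\<in>W. expm hat x \<in> V \<and> logm (expm hat x) = x) \<and>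
       (\<forall>Y\<in>V. logm Y \<in> W \<and> expm hat (logm Y) = Y))"

definition Ad :: "real ^ 'n ^ 'n \<Rightarrow> real ^ 'n ^ 'n \<Rightarrow> real ^ 'n ^ 'n" where
  "Ad X y = X ** y ** matrix_inv X"

definition Ad_vec ::
    "(real ^ 'd \<Rightarrow> real ^ 'n ^ 'n) \<Rightarrow> real ^ 'n ^ 'n \<Rightarrow> real ^ 'd \<Rightarrow> real ^ 'd" where
  "Ad_vec hat X w = vee hat (Ad X (hat w))"

definition adm :: "(real ^ 'd \<Rightarrow> real ^ 'n ^ 'n) \<Rightarrow> real ^ 'd \<Rightarrow> real ^ 'd ^ 'd" where
  "adm hat x = matrix (\<lambda>y. vee hat (bracket (hat x) (hat y)))"

definition dexpm :: "(real ^ 'd \<Rightarrow> real ^ 'n ^ 'n) \<Rightarrow> real ^ 'd \<Rightarrow> real ^ 'd ^ 'd" where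
  "dexpm hat x = (\<Sum>i. (1 / fact (i + 1)) *\<^sub>R mat_pow (adm hat x) i)"

definition affine_group_system ::
    "(real ^ 'n ^ 'n) set \<Rightarrow> (real ^ 'd) set \<Rightarrow>
     (real ^ 'd \<Rightarrow> real ^ 'n ^ 'n \<Rightarrow> real ^ 'n ^ 'n) \<Rightarrow> bool" where
  "affine_group_system G U f \<longleftrightarrow>
     (\<forall>u\<in>U. \<forall>X\<in>G. f u X \<in> tangent_space G X) \<and>
     (\<forall>u\<in>U. \<forall>X\<in>G. \<forall>Y\<in>G. f u (X ** Y) = f u X ** Y + X ** f u Y - X ** f u (mat 1) ** Y)"

(* A is the (Jacobian matrix of the) differential at 0 of x |-> (expm x)^-1 g (expm x), read in
   the coordinates given by vee; in particular that mapping is differentiable at 0. *)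
definition is_error_differential ::
    "(real ^ 'd \<Rightarrow> real ^ 'n ^ 'n) \<Rightarrow> (real ^ 'n ^ 'n \<Rightarrow> real ^ 'n ^ 'n) \<Rightarrow> real ^ 'd ^ 'd \<Rightarrow> bool"
  where
  "is_error_differential hat g A \<longleftrightarrow>
     ((\<lambda>x. vee hat (matrix_inv (expm hat x) ** g (expm hat x))) has_derivative (\<lambda>h. A *v h)) (at 0)"

(* The half-open interval from t0 to T, where T may be infinite. *)
definition time_interval :: "real \<Rightarrow> ereal \<Rightarrow> real set" where
  "time_interval t0 T = {t. t0 \<le> t \<and> ereal t < T}"

end

theory Submission
  imports Defs
begin

text \<open>Writing \<open>g\<close> for the drift of an invariant error \<open>\<eta>\<close>, the affine group property becomes the
  Leibniz rule \<open>g (X Y) = g X Y + X g Y\<close>. On a one-parameter group \<open>exp (s x)\<close> this makes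
  \<open>exp (- s x) g (exp (s x))\<close> a cocycle, so that it is determined by its derivative \<open>A x\<close> at
  \<open>s = 0\<close>; the outcome is \<open>exp (- x) g (exp x) = dexp (- x) (A x)\<close>. On the other hand the derivative
  of \<open>exp\<close> is \<open>h \<mapsto> exp x (dexp (- x) h)\<close>, and differentiating \<open>\<eta> = exp \<xi>\<close> gives
  \<open>dexp (- \<xi>) \<xi>' = w + dexp (- \<xi>) (A \<xi>)\<close>. Differentiability of \<open>\<xi>\<close> follows once \<open>log\<close> is known to be
  continuous; this is not assumed and is a consequence of the closed subgroup argument.\<close>

subsection \<open>The matrix exponential\<close>

text \<open>The exact cancellation has one source: the derivative of \<open>mat_exp\<close> and the
  cocycle of the drift are both given by the integral over r from 0 to 1 of exp (- r x) H exp (r x),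
  which is dexp (- x) H. Hence the same factor multiplies the derivative of \<xi> and the term A
  \<xi>. The minus sign comes from trivialising on the left. The obstacle is that \<open>G\<close>
  is only a closed subgroup. Invertibility of \<open>dexpm\<close> makes exp regular along the Lie
  algebra, but says nothing about points of \<open>G\<close> that might approach exp x from
  transverse directions. Adding a complement of the Lie algebra yields a parametrisation of a full
  neighbourhood among all matrices, and closedness then excludes a nonzero complement part.\<close>

lemma bounded_bilinear_matrix_mul:
  "bounded_bilinear ((**) :: real ^ 'n ^ 'm \<Rightarrow> real ^ 'p ^ 'n \<Rightarrow> real ^ 'p ^ 'm)"
  unfolding bilinear_conv_bounded_bilinear[symmetric] bilinear_def
  by (auto intro!: linearI simp: matrix_matrix_mult_def vec_eq_iff sum.distrib sum_distrib_left
      algebra_simps)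

interpretation matmul: bounded_bilinear "(**) :: real ^ 'n ^ 'n \<Rightarrow> real ^ 'n ^ 'n \<Rightarrow> real ^ 'n ^ 'n"
  by (rule bounded_bilinear_matrix_mul)

lemma matrix_inv_right_left:
  fixes A :: "'a::semiring_1 ^ 'n ^ 'm"
  assumes "invertible A"
  shows matrix_inv_right: "A ** matrix_inv A = mat 1"
    and matrix_inv_left: "matrix_inv A ** A = mat 1"
proof -
  have "A ** matrix_inv A = mat 1 \<and> matrix_inv A ** A = mat 1"
    unfolding matrix_inv_def by (rule someI_ex) (use assms in \<open>simp add: invertible_def\<close>)
  then show "A ** matrix_inv A = mat 1" "matrix_inv A ** A = mat 1" by auto
qed

lemma matrix_inv_unique:
  fixes A :: "'a::semiring_1 ^ 'n ^ 'n"
  assumes "A ** B = mat 1" "B ** A = mat 1"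
  shows "matrix_inv A = B"
proof -
  have "invertible A" using assms by (auto simp: invertible_def)
  then have "matrix_inv A ** A = mat 1" by (rule matrix_inv_left)
  then have "matrix_inv A ** A ** B = B" by simp
  then show ?thesis using assms by (simp add: matrix_mul_assoc[symmetric])
qed

text \<open>The real parameter is what matters: differentiation in \<open>s\<close> is a shift of
  the coefficients. One convergence argument then serves \<open>mat_exp\<close>, the conjugation
  series and the series of \<open>dexpm\<close>.\<close>

definition egf :: "(nat \<Rightarrow> 'a::euclidean_space) \<Rightarrow> real \<Rightarrow> 'a" where
  "egf c s = (\<Sum>k. (s ^ k / fact k) *\<^sub>R c k)"

text \<open>Against the factorials a geometric bound gives convergence for every \<open>s\<close>.
  The constants are hidden because shifting the sequence in either direction changes them.\<close>

definition geom_bounded :: "(nat \<Rightarrow> 'a::real_normed_vector) \<Rightarrow> bool" where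
  "geom_bounded c \<longleftrightarrow> (\<exists>C M. \<forall>k. norm (c k) \<le> C * M ^ k)"

lemma summable_norm_egf:
  assumes "\<And>k. norm (c k) \<le> C * M ^ k"
  shows "summable (\<lambda>k. norm ((s ^ k / fact k) *\<^sub>R c k))"
    and "(\<Sum>k. norm ((s ^ k / fact k) *\<^sub>R c k)) \<le> C * exp (M * \<bar>s\<bar>)"
proof -
  have sums: "(\<lambda>k. C * ((M * \<bar>s\<bar>) ^ k /\<^sub>R fact k)) sums (C * exp (M * \<bar>s\<bar>))"
    by (intro sums_mult exp_converges)
  have le: "norm ((s ^ k / fact k) *\<^sub>R c k) \<le> C * ((M * \<bar>s\<bar>) ^ k /\<^sub>R fact k)" for k
  proof -
    have "norm ((s ^ k / fact k) *\<^sub>R c k) = (\<bar>s\<bar> ^ k / fact k) * norm (c k)"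
      by (simp add: power_abs)
    also have "\<dots> \<le> (\<bar>s\<bar> ^ k / fact k) * (C * M ^ k)"
      by (intro mult_left_mono assms) auto
    finally show ?thesis by (simp add: field_simps)
  qed
  show "summable (\<lambda>k. norm ((s ^ k / fact k) *\<^sub>R c k))"
    by (rule summable_comparison_test'[OF sums_summable[OF sums], of 0]) (use le in auto)
  then have "(\<Sum>k. norm ((s ^ k / fact k) *\<^sub>R c k)) \<le> (\<Sum>k. C * ((M * \<bar>s\<bar>) ^ k /\<^sub>R fact k))"
    by (intro suminf_le le sums_summable[OF sums])
  then show "(\<Sum>k. norm ((s ^ k / fact k) *\<^sub>R c k)) \<le> C * exp (M * \<bar>s\<bar>)"
    using sums_unique[OF sums] by simp
qed

lemma summable_egf:
  fixes c :: "nat \<Rightarrow> 'a::euclidean_space"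
  assumes "geom_bounded c"
  shows "summable (\<lambda>k. (s ^ k / fact k) *\<^sub>R c k)"
proof -
  obtain C M where "norm (c k) \<le> C * M ^ k" for k using assms unfolding geom_bounded_def by blast
  from summable_norm_egf(1)[OF this, of s] show ?thesis by (rule summable_norm_cancel)
qed

lemma norm_egf_le:
  fixes c :: "nat \<Rightarrow> 'a::euclidean_space"
  assumes "\<And>k. norm (c k) \<le> C * M ^ k"
  shows "norm (egf c s) \<le> C * exp (M * \<bar>s\<bar>)"
  unfolding egf_def
  using summable_norm[OF summable_norm_egf(1)[OF assms]] summable_norm_egf(2)[OF assms]
  by (rule order_trans)

lemma egf_0 [simp]: "egf c 0 = c 0"
proof -
  have "egf c 0 = (\<Sum>k\<in>{0}. (0 ^ k / fact k) *\<^sub>R c k)"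
    unfolding egf_def by (rule suminf_finite) auto
  then show ?thesis by simp
qed

lemma egf_linear_image:
  fixes c :: "nat \<Rightarrow> 'a::euclidean_space" and T :: "'a \<Rightarrow> 'b::euclidean_space"
  assumes "linear T" "geom_bounded c"
  shows "T (egf c s) = egf (\<lambda>k. T (c k)) s"
  using bounded_linear.suminf[OF linear_conv_bounded_linear[THEN iffD1, OF assms(1)]
      summable_egf[OF assms(2), of s]] assms(1)
  unfolding egf_def by (simp add: linear_cmul)

lemma geom_bounded_Suc:
  assumes "geom_bounded c"
  shows "geom_bounded (\<lambda>k. c (Suc k))"
proof -
  obtain C M where "norm (c k) \<le> C * M ^ k" for k using assms unfolding geom_bounded_def by blast
  then have "norm (c (Suc k)) \<le> (C * M) * M ^ k" for k
    unfolding mult.assoc power_Suc[symmetric] by this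
  then show ?thesis unfolding geom_bounded_def by blast
qed

lemma has_vector_derivative_egf:
  fixes c :: "nat \<Rightarrow> 'a::euclidean_space"
  assumes "geom_bounded c"
  shows "(egf c has_vector_derivative egf (\<lambda>k. c (Suc k)) s) (at s)"
  unfolding has_vector_derivative_def
proof (subst has_derivative_componentwise_within, intro ballI)
  fix b :: 'a assume "b \<in> Basis"
  have inner: "egf d s \<bullet> b = (\<Sum>k. ((d k \<bullet> b) / fact k) * s ^ k)"
    and sm: "summable (\<lambda>k. ((d k \<bullet> b) / fact k) * s ^ k)" if d: "geom_bounded d" for d s
  proof -
    note S = bounded_linear.sums[OF bounded_linear_inner_left summable_sums[OF summable_egf[OF d, of s]],
        of b, folded egf_def]
    have "(\<lambda>k. ((d k \<bullet> b) / fact k) * s ^ k) sums (egf d s \<bullet> b)"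
      using S by (simp add: field_simps)
    then show "egf d s \<bullet> b = (\<Sum>k. ((d k \<bullet> b) / fact k) * s ^ k)"
      "summable (\<lambda>k. ((d k \<bullet> b) / fact k) * s ^ k)"
      by (simp_all add: sums_iff)
  qed
  \<comment> \<open>Tested against a basis vector, the series is a real power series; the factor k +
    1 produced by differentiation cancels against the factorial and leaves the shifted
    coefficients.\<close>
  have "diffs (\<lambda>k. (c k \<bullet> b) / fact k) = (\<lambda>k. (c (Suc k) \<bullet> b) / fact k)"
    by (simp add: diffs_def fun_eq_iff divide_simps del: of_nat_Suc)
  then have "((\<lambda>s. \<Sum>k. ((c k \<bullet> b) / fact k) * s ^ k) has_field_derivative
      (\<Sum>k. ((c (Suc k) \<bullet> b) / fact k) * s ^ k)) (at s)"
    using termdiffs_strong_converges_everywhere[OF sm[OF assms], of s] by simp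
  then show "((\<lambda>s. egf c s \<bullet> b) has_derivative
      (\<lambda>h. (h *\<^sub>R egf (\<lambda>k. c (Suc k)) s) \<bullet> b)) (at s)"
    by (simp add: inner[OF assms] inner[OF geom_bounded_Suc[OF assms]] has_field_derivative_def
        mult_commute_abs)
qed

section \<open>Powers and exponentials of a single matrix\<close>

lemma mat_pow_scaleR: "mat_pow (s *\<^sub>R A) k = s ^ k *\<^sub>R mat_pow A k"
  by (induction k) (simp_all add: matmul.scaleR_left matmul.scaleR_right)

text \<open>The factor \<open>norm (mat 1)\<close> stays because the Euclidean norm of the identity
  matrix is not 1 in general; \<open>K\<close> is the constant of the bilinear product.\<close>

lemma norm_mat_pow_le:
  fixes A :: "real ^ 'n ^ 'n"
  assumes "K > 0" "\<And>(A :: real ^ 'n ^ 'n) (B :: real ^ 'n ^ 'n). norm (A ** B) \<le> norm A * norm B * K"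
  shows "norm (mat_pow A k) \<le> norm (mat 1 :: real ^ 'n ^ 'n) * (K * norm A) ^ k"
proof (induction k)
  case (Suc k)
  have "norm (mat_pow A (Suc k)) \<le> norm A * norm (mat_pow A k) * K"
    unfolding mat_pow.simps by (rule assms(2))
  also have "\<dots> \<le> norm A * (norm (mat 1 :: real ^ 'n ^ 'n) * (K * norm A) ^ k) * K"
    using Suc assms(1) by (intro mult_right_mono mult_left_mono) auto
  finally show ?case by (simp add: algebra_simps)
qed simp

lemma geom_bounded_mat_pow:
  fixes A :: "real ^ 'n ^ 'n"
  shows "geom_bounded (mat_pow A)"
proof -
  obtain K :: real where K: "K > 0" "\<And>(A :: real ^ 'n ^ 'n) (B :: real ^ 'n ^ 'n). norm (A ** B) \<le> norm A * norm B * K"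
    using matmul.pos_bounded by blast
  show ?thesis unfolding geom_bounded_def using norm_mat_pow_le[OF K, of A] by blast
qed

lemma mat_exp_scaleR: "mat_exp (s *\<^sub>R A) = egf (mat_pow A) s"
  unfolding mat_exp_def egf_def by (simp add: mat_pow_scaleR)

lemma mat_exp_eq_egf: "mat_exp A = egf (mat_pow A) 1"
  using mat_exp_scaleR[of 1 A] by simp

lemma mat_exp_0 [simp]: "mat_exp 0 = mat 1"
  using mat_exp_scaleR[of 0 "0 :: real ^ 'n ^ 'n"] by simp

text \<open>\<open>K\<close> and \<open>C\<close> do not depend on \<open>A\<close>, so that the
  remainder estimate for \<open>mat_exp\<close> can bound all exponentials on a ball by one
  constant.\<close>

lemma norm_mat_exp_le:
  obtains K C :: real where "K > 0" "C > 0"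
    "\<And>A :: real ^ 'n ^ 'n. norm (mat_exp A) \<le> C * exp (K * norm A)"
proof -
  obtain K :: real where K: "K > 0" "\<And>(A :: real ^ 'n ^ 'n) (B :: real ^ 'n ^ 'n). norm (A ** B) \<le> norm A * norm B * K"
    using matmul.pos_bounded by blast
  have "norm (mat_exp A) \<le> norm (mat 1 :: real ^ 'n ^ 'n) * exp (K * norm A)"
    for A :: "real ^ 'n ^ 'n"
    using norm_egf_le[OF norm_mat_pow_le[OF K], of A 1] by (simp add: mat_exp_eq_egf)
  moreover have "norm (mat 1 :: real ^ 'n ^ 'n) > 0"
    by (simp add: mat_def vec_eq_iff)
  ultimately show ?thesis using that K(1) by blast
qed

lemma mat_pow_commute: "mat_pow A k ** A = A ** mat_pow A k"
  by (induction k) (simp_all add: matrix_mul_assoc[symmetric])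

lemma mat_exp_commute:
  fixes A :: "real ^ 'n ^ 'n"
  shows "mat_exp (s *\<^sub>R A) ** A = A ** mat_exp (s *\<^sub>R A)"
proof -
  have "linear (\<lambda>B :: real ^ 'n ^ 'n. B ** A)" "linear ((**) A :: real ^ 'n ^ 'n \<Rightarrow> _)"
    by (auto intro!: linearI simp: matmul.add_left matmul.add_right matmul.scaleR_left matmul.scaleR_right)
  from egf_linear_image[OF this(1) geom_bounded_mat_pow, of A s]
    egf_linear_image[OF this(2) geom_bounded_mat_pow, of A s]
  show ?thesis by (simp add: mat_exp_scaleR mat_pow_commute)
qed

lemma has_vector_derivative_mat_exp_scaleR:
  fixes A :: "real ^ 'n ^ 'n"
  shows "((\<lambda>s. mat_exp (s *\<^sub>R A)) has_vector_derivative A ** mat_exp (s *\<^sub>R A)) (at s within S)"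
proof -
  have "linear ((**) A :: real ^ 'n ^ 'n \<Rightarrow> _)"
    by (auto intro!: linearI simp: matmul.add_right matmul.scaleR_right)
  from egf_linear_image[OF this geom_bounded_mat_pow, of A s]
    has_vector_derivative_egf[OF geom_bounded_mat_pow, of A s]
  show ?thesis
    by (simp add: mat_exp_scaleR has_vector_derivative_at_within)
qed

lemma has_vector_derivative_mat_exp_scaleR_right:
  "((\<lambda>s. mat_exp (s *\<^sub>R A)) has_vector_derivative mat_exp (s *\<^sub>R A) ** A) (at s within S)"
  using has_vector_derivative_mat_exp_scaleR by (simp add: mat_exp_commute)

lemma has_vector_derivative_mat_exp_minus_scaleR:
  "((\<lambda>s. mat_exp (- (s *\<^sub>R A))) has_vector_derivative - (mat_exp (- (s *\<^sub>R A)) ** A)) (at s within S)"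
  using has_vector_derivative_mat_exp_scaleR_right[where A="-A"]
  by (simp add: matmul.minus_right)

text \<open>The functional equations of \<open>mat_exp\<close> come from this instead of Cauchy
  products: a suitable product has zero derivative in \<open>s\<close>, and its values at two
  parameters are compared.\<close>

lemma has_vector_derivative_zero_eq:
  fixes f :: "real \<Rightarrow> 'a::real_normed_vector"
  assumes "\<And>s. (f has_vector_derivative 0) (at s)"
  shows "f a = f b"
  using has_derivative_zero_unique[of UNIV f a b] assms
  by (simp add: has_vector_derivative_def)

lemma mat_exp_minus_left: "mat_exp (- A) ** mat_exp A = mat 1"
proof -
  have "((\<lambda>s. mat_exp (- (s *\<^sub>R A)) ** mat_exp (s *\<^sub>R A)) has_vector_derivative 0) (at s)" for s
    by (rule has_vector_derivative_eq_rhs[OF matmul.has_vector_derivative[OF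
      has_vector_derivative_mat_exp_minus_scaleR has_vector_derivative_mat_exp_scaleR]])
      (simp add: matmul.minus_left matrix_mul_assoc)
  from has_vector_derivative_zero_eq[of "\<lambda>s. mat_exp (- (s *\<^sub>R A)) ** mat_exp (s *\<^sub>R A)", OF this, of 1 0]
  show ?thesis by simp
qed

lemma mat_exp_minus_right: "mat_exp A ** mat_exp (- A) = mat 1"
  using mat_exp_minus_left[of "- A"] by simp

lemma invertible_mat_exp: "invertible (mat_exp A)"
  unfolding invertible_def using mat_exp_minus_left mat_exp_minus_right by blast

lemma matrix_inv_mat_exp: "matrix_inv (mat_exp A) = mat_exp (- A)"
  by (intro matrix_inv_unique mat_exp_minus_left mat_exp_minus_right)

lemma mat_exp_add_scaleR: "mat_exp ((s + r) *\<^sub>R A) = mat_exp (s *\<^sub>R A) ** mat_exp (r *\<^sub>R A)"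
proof -
  have "((\<lambda>s. mat_exp (- (s *\<^sub>R A)) ** mat_exp ((r + s) *\<^sub>R A)) has_vector_derivative 0) (at s)" for s
  proof -
    have "((\<lambda>s. mat_exp ((r + s) *\<^sub>R A)) has_vector_derivative (A ** mat_exp ((r + s) *\<^sub>R A))) (at s)"
    proof -
      have "((+) r has_vector_derivative 1) (at s)"
        by (auto intro!: derivative_eq_intros)
      from vector_diff_chain_at[OF this has_vector_derivative_mat_exp_scaleR]
      show ?thesis by (simp add: o_def)
    qed
    then show ?thesis
      by (rule has_vector_derivative_eq_rhs[OF matmul.has_vector_derivative[OF
            has_vector_derivative_mat_exp_minus_scaleR]])
        (simp add: matmul.minus_left matrix_mul_assoc)
  qed
  from has_vector_derivative_zero_eq[of "\<lambda>s. mat_exp (- (s *\<^sub>R A)) ** mat_exp ((r + s) *\<^sub>R A)", OF this, of s 0]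
  have *: "mat_exp (- (s *\<^sub>R A)) ** mat_exp ((r + s) *\<^sub>R A) = mat_exp (r *\<^sub>R A)"
    by simp
  show "mat_exp ((s + r) *\<^sub>R A) = mat_exp (s *\<^sub>R A) ** mat_exp (r *\<^sub>R A)"
    unfolding *[symmetric] by (simp add: matrix_mul_assoc mat_exp_minus_right add.commute)
qed

subsection \<open>The Frechet derivative of the matrix exponential\<close>

lemma norm_increment_le:
  fixes f :: "real \<Rightarrow> 'a::real_normed_vector"
  assumes deriv: "\<And>s. (f has_vector_derivative f' s) (at s)"
    and bound: "\<And>s. s \<in> {0..1} \<Longrightarrow> norm (f' s) \<le> B" and s: "s \<in> {0..1}"
  shows "norm (f s - f 0) \<le> B"
proof -
  have "norm (f s - f 0) \<le> B * norm (s - 0)"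
  proof (rule differentiable_bound[where f' = "\<lambda>x h. h *\<^sub>R f' x" and S = "{0..1}"])
    show "(f has_derivative (\<lambda>h. h *\<^sub>R f' x)) (at x within {0..1})" for x
      using has_vector_derivative_at_within[OF deriv] by (simp add: has_vector_derivative_def)
    show "onorm (\<lambda>h. h *\<^sub>R f' x) \<le> B" if "x \<in> {0..1}" for x
      by (rule onorm_le) (use bound[OF that] in \<open>simp add: mult.commute[of B] mult_left_mono\<close>)
  qed (use s in auto)
  also have "\<dots> \<le> B"
    using s order_trans[OF norm_ge_zero bound[of 0]] by (simp add: mult_left_le)
  finally show ?thesis .
qed

lemma linear_bracket_left: "linear (\<lambda>B. bracket B A)"
  by (rule linearI) (simp_all add: bracket_def matmul.add_left matmul.add_right matmul.scaleR_left
      matmul.scaleR_right algebra_simps)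

lemma linear_bracket_pow: "linear ((\<lambda>B. bracket B A) ^^ k)"
proof (induction k)
  case 0
  show ?case by (simp add: linear_id[unfolded id_def] id_def)
next
  case (Suc k)
  show ?case unfolding funpow.simps by (rule linear_compose[OF Suc linear_bracket_left])
qed

lemma geom_bounded_bracket_pow:
  fixes A H :: "real ^ 'n ^ 'n"
  shows "geom_bounded (\<lambda>k. ((\<lambda>B. bracket B A) ^^ k) H)"
proof -
  obtain K where K: "\<And>B. norm (bracket B A) \<le> norm B * K"
    using bounded_linear.bounded[OF linear_conv_bounded_linear[THEN iffD1, OF linear_bracket_left[of A]]]
    by blast
  \<comment> \<open>The induction below multiplies inequalities by this constant, so its sign must
    be known.\<close>
  then have K: "norm (bracket B A) \<le> norm B * \<bar>K\<bar>" for B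
    by (rule order_trans) (simp add: mult_left_mono)
  have "norm (((\<lambda>B. bracket B A) ^^ k) H) \<le> norm H * \<bar>K\<bar> ^ k" for k
  proof (induction k)
    case (Suc k)
    have "norm (((\<lambda>B. bracket B A) ^^ Suc k) H) \<le> norm (((\<lambda>B. bracket B A) ^^ k) H) * \<bar>K\<bar>"
      using K by simp
    also have "\<dots> \<le> norm H * \<bar>K\<bar> ^ k * \<bar>K\<bar>" using Suc by (rule mult_right_mono) simp
    finally show ?case by (simp add: mult_ac)
  qed simp
  then show ?thesis unfolding geom_bounded_def by blast
qed

text \<open>Bracketing with \<open>A\<close> on the right is minus the adjoint action of
  \<open>A\<close>, so this is exp (- s ad A) = Ad (exp (- s A)). The series \<psi> solves \<psi>' =
  [\<psi>, A], which makes exp (s A) \<psi> exp (- s A) constant.\<close>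

lemma egf_bracket_pow:
  fixes A H :: "real ^ 'n ^ 'n"
  shows "egf (\<lambda>k. ((\<lambda>B. bracket B A) ^^ k) H) s = mat_exp (- (s *\<^sub>R A)) ** H ** mat_exp (s *\<^sub>R A)"
proof -
  define \<psi> where "\<psi> = egf (\<lambda>k. ((\<lambda>B. bracket B A) ^^ k) H)"
  have \<psi>: "(\<psi> has_vector_derivative bracket (\<psi> s) A) (at s)" for s
    using has_vector_derivative_egf[OF geom_bounded_bracket_pow, of A H s]
      egf_linear_image[OF linear_bracket_left[of A] geom_bounded_bracket_pow[of A H], of s]
    by (simp add: \<psi>_def)
  have "((\<lambda>s. (mat_exp (s *\<^sub>R A) ** \<psi> s) ** mat_exp (s *\<^sub>R - A)) has_vector_derivative 0) (at s)" for s
    by (rule has_vector_derivative_eq_rhs[OF matmul.has_vector_derivative[OF matmul.has_vector_derivative[OF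
      has_vector_derivative_mat_exp_scaleR_right \<psi>] has_vector_derivative_mat_exp_scaleR]])
      (simp add: bracket_def matmul.minus_left matmul.minus_right matmul.diff_left matmul.diff_right
        matmul.add_left matrix_mul_assoc)
  from has_vector_derivative_zero_eq[of "\<lambda>s. (mat_exp (s *\<^sub>R A) ** \<psi> s) ** mat_exp (s *\<^sub>R - A)", OF this, of s 0]
  have *: "mat_exp (s *\<^sub>R A) ** \<psi> s ** mat_exp (- (s *\<^sub>R A)) = H" by (simp add: \<psi>_def)
  have "\<psi> s = (mat_exp (- (s *\<^sub>R A)) ** mat_exp (s *\<^sub>R A)) ** \<psi> s **
    (mat_exp (- (s *\<^sub>R A)) ** mat_exp (s *\<^sub>R A))"
    by (simp add: mat_exp_minus_left)
  also have "\<dots> = mat_exp (- (s *\<^sub>R A)) ** (mat_exp (s *\<^sub>R A) ** \<psi> s ** mat_exp (- (s *\<^sub>R A))) **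
    mat_exp (s *\<^sub>R A)"
    by (simp only: matrix_mul_assoc)
  finally show ?thesis unfolding * by (simp only: \<psi>_def)
qed

text \<open>The power series of \<open>\<integral>\<^sub>0\<^sup>s exp (- r A) H exp (r A) dr\<close>; at \<open>s = 1\<close> it is \<open>dexp (- A) H\<close>.\<close>
definition conj_integral :: "real ^ 'n ^ 'n \<Rightarrow> real ^ 'n ^ 'n \<Rightarrow> real \<Rightarrow> real ^ 'n ^ 'n" where
  "conj_integral A H = egf (case_nat 0 (\<lambda>k. ((\<lambda>B. bracket B A) ^^ k) H))"

text \<open>Prepending 0 to the coefficients is integration of the series from 0.\<close>

lemma geom_bounded_case_nat:
  fixes c :: "nat \<Rightarrow> 'a::real_normed_vector"
  assumes "geom_bounded c"
  shows "geom_bounded (case_nat 0 c)"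
proof -
  obtain C M where CM: "\<And>k. norm (c k) \<le> C * M ^ k" using assms unfolding geom_bounded_def by blast
  have C: "0 \<le> C" using order_trans[OF norm_ge_zero CM[of 0]] by simp
  \<comment> \<open>The coefficients are delayed by one index; a base of at least 1 lets the
    exponent grow by one without spoiling the bound.\<close>
  have "norm (case_nat 0 c k) \<le> C * max 1 \<bar>M\<bar> ^ k" for k
  proof (cases k)
    case (Suc j)
    have "norm (c j) \<le> C * \<bar>M\<bar> ^ j"
      by (rule order_trans[OF CM mult_left_mono[OF _ C]]) (simp add: power_abs[symmetric])
    also have "\<dots> \<le> C * max 1 \<bar>M\<bar> ^ j" using C by (intro mult_left_mono power_mono) auto
    also have "\<dots> \<le> C * max 1 \<bar>M\<bar> ^ k" unfolding Suc
      using C by (intro mult_left_mono power_increasing) auto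
    finally show ?thesis using Suc by simp
  qed (use C in simp)
  then show ?thesis unfolding geom_bounded_def by blast
qed

lemma conj_integral_0 [simp]: "conj_integral A H 0 = 0"
  by (simp add: conj_integral_def)

lemma has_vector_derivative_conj_integral:
  "(conj_integral A H has_vector_derivative mat_exp (- (s *\<^sub>R A)) ** H ** mat_exp (s *\<^sub>R A)) (at s)"
  using has_vector_derivative_egf[OF geom_bounded_case_nat[OF geom_bounded_bracket_pow], of A H s]
  unfolding conj_integral_def by (simp add: egf_bracket_pow)

lemma linear_egf:
  fixes c :: "nat \<Rightarrow> 'a::real_vector \<Rightarrow> 'b::euclidean_space"
  assumes "\<And>k. linear (c k)" "\<And>x. geom_bounded (\<lambda>k. c k x)"
  shows "linear (\<lambda>x. egf (\<lambda>k. c k x) s)"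
proof (rule linearI)
  fix x y
  show "egf (\<lambda>k. c k (x + y)) s = egf (\<lambda>k. c k x) s + egf (\<lambda>k. c k y) s"
    unfolding egf_def
    by (subst suminf_add[OF summable_egf[OF assms(2)] summable_egf[OF assms(2)]])
      (simp add: linear_add[OF assms(1)] scaleR_add_right)
next
  fix r x
  show "egf (\<lambda>k. c k (r *\<^sub>R x)) s = r *\<^sub>R egf (\<lambda>k. c k x) s"
    unfolding egf_def
    by (subst suminf_scaleR_right[OF summable_egf[OF assms(2)]])
      (simp add: linear_cmul[OF assms(1)] mult.commute)
qed

lemma linear_conj_integral: "linear (\<lambda>H. conj_integral A H s)"
  unfolding conj_integral_def
proof (rule linear_egf[where c = "\<lambda>k H. case_nat 0 (\<lambda>k. ((\<lambda>B. bracket B A) ^^ k) H) k"])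
  fix k show "linear (\<lambda>H. case_nat 0 (\<lambda>k. ((\<lambda>B. bracket B A) ^^ k) H) k)"
    by (cases k) (simp_all add: linear_bracket_pow eta_contract_eq module_hom_zero)
qed (rule geom_bounded_case_nat[OF geom_bounded_bracket_pow])

text \<open>Variation of constants: exp (- s A) exp (s (A + H)) and the conjugation integral have
  derivatives differing by exp (- s A) H (exp (s (A + H)) - exp (s A)). Both \<open>H\<close> and
  the last factor are of first order in \<open>H\<close>.\<close>

lemma mat_exp_quadratic_error:
  fixes A :: "real ^ 'n ^ 'n"
  obtains C where "\<And>H. norm H \<le> 1 \<Longrightarrow>
    norm (mat_exp (A + H) - mat_exp A - mat_exp A ** conj_integral A H 1) \<le> C * (norm H)\<^sup>2"
proof -
  obtain k :: real where k0: "k > 0"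
    and k: "\<And>(A :: real ^ 'n ^ 'n) (B :: real ^ 'n ^ 'n). norm (A ** B) \<le> norm A * norm B * k"
    using matmul.pos_bounded by blast
  obtain K C :: real where K: "K > 0" "C > 0"
    "\<And>A :: real ^ 'n ^ 'n. norm (mat_exp A) \<le> C * exp (K * norm A)"
    by (rule norm_mat_exp_le) blast
  \<comment> \<open>The ball of radius \<open>norm A + 1\<close> contains all multiples by s in
    [0, 1] of \<open>A\<close>, \<open>- A\<close> and \<open>A + H\<close>, since
    \<open>norm H \<le> 1\<close>.\<close>
  define M where "M = C * exp (K * (norm A + 1))"
  have M: "norm (mat_exp B) \<le> M" if "norm B \<le> norm A + 1" for B :: "real ^ 'n ^ 'n"
    unfolding M_def by (rule order_trans[OF K(3)]) (use K that in auto)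
  have mul: "norm (B ** B') \<le> b * b' * k" if "norm B \<le> b" "norm B' \<le> b'"
    for B B' :: "real ^ 'n ^ 'n" and b b'
    by (rule order_trans[OF k]) (use that k0 norm_ge_zero[of B] in \<open>intro mult_right_mono mult_mono; linarith?; simp\<close>)
  \<comment> \<open>The estimate bounds five exponentials by \<open>M\<close> and six matrix
    products by \<open>k\<close> each.\<close>
  have "norm (mat_exp (A + H) - mat_exp A - mat_exp A ** conj_integral A H 1) \<le> (M ^ 5 * k ^ 6) * (norm H)\<^sup>2"
    if H: "norm H \<le> 1" for H
  proof -
    have sA: "norm (s *\<^sub>R B) \<le> norm A + 1" if "s \<in> {0..1}" "norm B \<le> norm A + 1"
      for s and B :: "real ^ 'n ^ 'n"
      using that mult_right_mono[of s 1 "norm B"] by auto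
    have AH: "norm (A + H) \<le> norm A + 1" using H norm_triangle_le by (smt (verit))
    define \<phi> where "\<phi> s = mat_exp (- (s *\<^sub>R A)) ** mat_exp (s *\<^sub>R (A + H))" for s
    have \<phi>: "(\<phi> has_vector_derivative (mat_exp (- (s *\<^sub>R A)) ** H) ** mat_exp (s *\<^sub>R (A + H))) (at s)" for s
      unfolding \<phi>_def
      by (rule has_vector_derivative_eq_rhs[OF matmul.has_vector_derivative[OF
            has_vector_derivative_mat_exp_minus_scaleR has_vector_derivative_mat_exp_scaleR]])
        (simp add: matmul.minus_left matmul.add_left matmul.add_right matrix_mul_assoc)
    have E1: "norm (mat_exp (- (s *\<^sub>R A))) \<le> M" if "s \<in> {0..1}" for s
      using sA[of s "- A"] that by (intro M) simp
    have E2: "norm (mat_exp (s *\<^sub>R (A + H))) \<le> M" if "s \<in> {0..1}" for s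
      using sA[of s "A + H"] that AH by (intro M) simp
    have E3: "norm (mat_exp (s *\<^sub>R A)) \<le> M" if "s \<in> {0..1}" for s
      using sA[of s "A"] that by (intro M) simp
    have "norm (\<phi> s - \<phi> 0) \<le> (M * norm H * k) * M * k" if "s \<in> {0..1}" for s
      by (rule norm_increment_le[OF \<phi> _ that]) (intro mul E1 E2 order_refl)
    then have \<phi>1: "norm (\<phi> s - mat 1) \<le> (M * norm H * k) * M * k" if "s \<in> {0..1}" for s
      using that by (simp add: \<phi>_def)
    have "mat_exp (s *\<^sub>R (A + H)) - mat_exp (s *\<^sub>R A) = mat_exp (s *\<^sub>R A) ** (\<phi> s - mat 1)" for s
      by (simp add: \<phi>_def matmul.diff_right matrix_mul_assoc mat_exp_minus_right)
    then have D: "norm (mat_exp (s *\<^sub>R (A + H)) - mat_exp (s *\<^sub>R A)) \<le> M * ((M * norm H * k) * M * k) * k"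
      if "s \<in> {0..1}" for s
      using mul[OF E3[OF that] \<phi>1[OF that]] by simp
    have deriv: "((\<lambda>s. \<phi> s - conj_integral A H s) has_vector_derivative
        (mat_exp (- (s *\<^sub>R A)) ** H) ** (mat_exp (s *\<^sub>R (A + H)) - mat_exp (s *\<^sub>R A))) (at s)" for s
      by (rule has_vector_derivative_eq_rhs[OF has_vector_derivative_diff[OF \<phi>
            has_vector_derivative_conj_integral]]) (simp add: matmul.diff_right)
    have "norm ((\<phi> 1 - conj_integral A H 1) - (\<phi> 0 - conj_integral A H 0)) \<le>
        (M * norm H * k) * (M * ((M * norm H * k) * M * k) * k) * k"
      by (rule norm_increment_le[OF deriv]) (intro mul E1 D order_refl | simp)+
    then have "norm (\<phi> 1 - conj_integral A H 1 - mat 1) \<le>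
        (M * norm H * k) * (M * ((M * norm H * k) * M * k) * k) * k"
      by (simp add: \<phi>_def)
    from mul[OF E3[of 1] this]
    have "norm (mat_exp A ** (\<phi> 1 - conj_integral A H 1 - mat 1)) \<le> (M ^ 5 * k ^ 6) * (norm H)\<^sup>2"
      by (simp add: power2_eq_square eval_nat_numeral mult_ac)
    moreover have "mat_exp A ** (\<phi> 1 - conj_integral A H 1 - mat 1) =
        mat_exp (A + H) - mat_exp A - mat_exp A ** conj_integral A H 1"
      by (simp add: \<phi>_def matmul.diff_right matrix_mul_assoc mat_exp_minus_right)
    ultimately show ?thesis by simp
  qed
  then show ?thesis using that by blast
qed

lemma has_derivative_mat_exp:
  fixes A :: "real ^ 'n ^ 'n"
  shows "(mat_exp has_derivative (\<lambda>H. mat_exp A ** conj_integral A H 1)) (at A)"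
proof -
  obtain C where C: "\<And>H. norm H \<le> 1 \<Longrightarrow>
    norm (mat_exp (A + H) - mat_exp A - mat_exp A ** conj_integral A H 1) \<le> C * (norm H)\<^sup>2"
    using mat_exp_quadratic_error[of A] by blast
  have lin: "bounded_linear (\<lambda>H. mat_exp A ** conj_integral A H 1)"
    using linear_conj_integral linear_conv_bounded_linear matmul.bounded_linear_right
      bounded_linear_compose by blast
  show ?thesis
  proof (rule has_derivativeI_sandwich[where e = 1 and H = "\<lambda>B. C * norm (B - A)"])
    show "((\<lambda>B. C * norm (B - A)) \<longlongrightarrow> 0) (at A)"
      by (rule tendsto_eq_intros refl | simp)+
    fix B assume "B \<noteq> A" and d: "dist B A < 1"
    then show "norm (mat_exp B - mat_exp A - mat_exp A ** conj_integral A (B - A) 1) / norm (B - A)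
        \<le> C * norm (B - A)"
      using C[of "B - A"] by (simp add: dist_norm divide_le_eq power2_eq_square mult.assoc)
  qed (use lin in auto)
qed

lemma continuous_on_mat_exp: "continuous_on S mat_exp"
  using has_derivative_mat_exp has_derivative_continuous
  by (blast intro: continuous_at_imp_continuous_on)

subsection \<open>Matrix Lie groups\<close>

lemma mat_exp_of_nat: "mat_exp (real k *\<^sub>R A) = mat_pow (mat_exp A) k"
proof (induction k)
  case (Suc k)
  have "mat_exp (real (Suc k) *\<^sub>R A) = mat_exp ((1 + real k) *\<^sub>R A)" by simp
  then show ?case unfolding mat_exp_add_scaleR using Suc by simp
qed simp

text \<open>The factorial of i + 1 is the delay by one index, so \<open>dexpm\<close> is an
  integrated exponential series evaluated at 1.\<close>

lemma dexpm_eq_egf: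
  "dexpm hat x = egf (case_nat 0 (mat_pow (adm hat x))) 1"
  unfolding dexpm_def egf_def
  using suminf_split_head[OF summable_egf[OF geom_bounded_case_nat[OF geom_bounded_mat_pow[of "adm hat x"]], of 1]]
  by simp

locale lie_group_chart =
  fixes G V :: "(real ^ 'n ^ 'n) set"
    and hat :: "real ^ 'd \<Rightarrow> real ^ 'n ^ 'n"
    and logm :: "real ^ 'n ^ 'n \<Rightarrow> real ^ 'd"
  assumes G: "matrix_lie_group G"
    and hat: "lie_algebra_iso G hat"
    and logm: "local_log G hat V logm"
begin

lemma linear_hat: "linear hat" and range_hat: "range hat = lie_algebra G" and inj_hat: "inj hat"
  using hat by (auto simp: lie_algebra_iso_def bij_betw_def)

lemma vee_hat [simp]: "vee hat (hat x) = x"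
  by (simp add: vee_def inj_hat)

lemma hat_vee: "y \<in> lie_algebra G \<Longrightarrow> hat (vee hat y) = y"
  by (simp add: vee_def range_hat[symmetric] f_inv_into_f)

lemma hat_in [simp]: "hat x \<in> lie_algebra G"
  using range_hat by blast

lemma one_in [simp]: "mat 1 \<in> G"
  and mult_in [simp]: "A \<in> G \<Longrightarrow> B \<in> G \<Longrightarrow> A ** B \<in> G"
  and inv_in [simp]: "A \<in> G \<Longrightarrow> matrix_inv A \<in> G"
  and invertible_in: "A \<in> G \<Longrightarrow> invertible A"
proof -
  have "G \<subseteq> GL" using G closedin_imp_subset unfolding matrix_lie_group_def by blast
  then show "A \<in> G \<Longrightarrow> invertible A" by (auto simp: GL_def)
qed (use G in \<open>auto simp: matrix_lie_group_def\<close>)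

lemma inv_mult_cancel [simp]: "A \<in> G \<Longrightarrow> matrix_inv A ** A = mat 1"
  and mult_inv_cancel [simp]: "A \<in> G \<Longrightarrow> A ** matrix_inv A = mat 1"
  using invertible_in matrix_inv_left matrix_inv_right by blast+

text \<open>\<open>G\<close> is closed only relative to \<open>GL\<close>; a limit of group elements
  could be singular, hence the third assumption.\<close>

lemma limit_in:
  assumes "X \<longlonglongrightarrow> A" "\<And>k. X k \<in> G" "invertible A"
  shows "A \<in> G"
proof -
  obtain T where "closed T" "G = GL \<inter> T"
    using G by (auto simp: matrix_lie_group_def closedin_closed)
  then show ?thesis using assms closed_sequentially[of T X A] by (auto simp: GL_def)
qed

lemma mat_pow_in: "A \<in> G \<Longrightarrow> mat_pow A k \<in> G"
  by (induction k) auto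

lemma mat_exp_minus_in: "mat_exp A \<in> G \<Longrightarrow> mat_exp (- A) \<in> G"
  using inv_in[of "mat_exp A"] by (simp add: matrix_inv_mat_exp)

text \<open>\<open>local_log\<close> places exponentials of small vectors in \<open>G\<close>. A
  general \<open>x\<close> is divided by a large integer \<open>k\<close>, and the k-th power of the
  small exponential recovers it.\<close>

lemma mat_exp_hat_in [simp]: "mat_exp (hat x) \<in> G"
proof -
  obtain W where W: "open W" "0 \<in> W" "\<And>x. x \<in> W \<Longrightarrow> mat_exp (hat x) \<in> G"
    using logm openin_imp_subset[of "top_of_set G" V] unfolding local_log_def expm_def
    by (metis openin_subset subset_iff topspace_euclidean_subtopology)
  obtain e where e: "e > 0" "ball 0 e \<subseteq> W" using W openE by blast
  obtain k :: nat where k: "norm x / e < real k" using reals_Archimedean2 by blast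
  have "norm x < real k * e" using k e by (simp add: field_simps)
  moreover from this have k0: "k > 0" by (cases k) auto
  ultimately have "inverse (real k) *\<^sub>R x \<in> W" using e by (auto simp: field_simps)
  from mat_pow_in[OF W(3)[OF this], of k] k0 show ?thesis
    by (simp add: mat_exp_of_nat[symmetric] linear_cmul[OF linear_hat])
qed

section \<open>Tangent spaces, translations and the adjoint action\<close>

lemma tangent_linear_image:
  assumes v: "v \<in> tangent_space G X" and T: "bounded_linear T" and TG: "\<And>A. A \<in> G \<Longrightarrow> T A \<in> G"
  shows "T v \<in> tangent_space G (T X)"
proof -
  obtain \<gamma> \<epsilon> where \<gamma>: "\<epsilon> > 0" "\<And>s. s \<in> {-\<epsilon><..<\<epsilon>} \<Longrightarrow> \<gamma> s \<in> G \<and> \<gamma> differentiable (at s)"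
    "\<gamma> 0 = X" "(\<gamma> has_vector_derivative v) (at 0)"
    using v unfolding tangent_space_def by blast
  show ?thesis unfolding tangent_space_def
  proof (intro CollectI exI[of _ "\<lambda>s. T (\<gamma> s)"] exI[of _ \<epsilon>] conjI ballI)
    fix s assume s: "s \<in> {-\<epsilon><..<\<epsilon>}"
    then show "T (\<gamma> s) \<in> G" using \<gamma>(2) TG by simp
    obtain D where "(\<gamma> has_derivative D) (at s)" using \<gamma>(2)[OF s] unfolding differentiable_def by blast
    from bounded_linear.has_derivative[OF T this]
    show "(\<lambda>s. T (\<gamma> s)) differentiable (at s)" by (rule differentiableI)
  qed (use \<gamma> bounded_linear.has_vector_derivative[OF T] in simp_all)
qed

lemma tangent_mult_left:
  "v \<in> tangent_space G X \<Longrightarrow> Y \<in> G \<Longrightarrow> Y ** v \<in> tangent_space G (Y ** X)"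
  by (rule tangent_linear_image) (simp_all add: matmul.bounded_linear_right)

lemma tangent_mult_right:
  "v \<in> tangent_space G X \<Longrightarrow> Y \<in> G \<Longrightarrow> v ** Y \<in> tangent_space G (X ** Y)"
  by (rule tangent_linear_image[where T = "\<lambda>A. A ** Y"]) (simp_all add: matmul.bounded_linear_left)

lemma tangent_to_lie_algebra:
  assumes "v \<in> tangent_space G X" "X \<in> G"
  shows "matrix_inv X ** v \<in> lie_algebra G"
  using tangent_mult_left[OF assms(1) inv_in[OF assms(2)]] assms(2) by (simp add: lie_algebra_def)

lemma Ad_in:
  assumes "X \<in> G"
  shows "Ad X (hat y) \<in> lie_algebra G"
  using tangent_mult_right[OF tangent_mult_left[OF hat_in[of y, unfolded lie_algebra_def] assms]
      inv_in[OF assms]] assms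
  by (simp add: Ad_def lie_algebra_def)

lemma hat_Ad_vec: "X \<in> G \<Longrightarrow> hat (Ad_vec hat X y) = Ad X (hat y)"
  by (simp add: Ad_vec_def hat_vee Ad_in)

text \<open>With tangent vectors defined through curves this is not immediate; it is read off from
  the Lie algebra being the image of the linear map \<open>hat\<close>.\<close>

lemma lie_algebra_diff: "a \<in> lie_algebra G \<Longrightarrow> b \<in> lie_algebra G \<Longrightarrow> a - b \<in> lie_algebra G"
  using linear_subspace_image[OF linear_hat subspace_UNIV]
  by (simp add: range_hat subspace_diff)

text \<open>\<open>vee\<close> is controlled only on the Lie algebra, whereas \<open>L\<close> is
  linear on all matrices, hence continuous. Its kernel is the complement of the Lie algebra used
  below.\<close>

lemma left_inverse_hat:
  obtains L where "linear L" "\<And>x. L (hat x) = x"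
  using linear_injective_left_inverse[OF linear_hat inj_hat] by (metis comp_apply id_apply)

text \<open>The bracket is the velocity at 0 of Ad (exp (s x)) y, a curve inside the Lie algebra.
  The linear map hat o L fixes that curve pointwise, hence also its velocity.\<close>

lemma bracket_in: "bracket (hat x) (hat y) \<in> lie_algebra G"
proof -
  obtain L where L: "linear L" "\<And>x. L (hat x) = x" by (rule left_inverse_hat) blast
  define c where "c s = (mat_exp (s *\<^sub>R hat x) ** hat y) ** mat_exp (s *\<^sub>R - hat x)" for s
  have deriv: "(c has_vector_derivative bracket (hat x) (hat y)) (at 0)"
    unfolding c_def
    by (rule has_vector_derivative_eq_rhs[OF matmul.has_vector_derivative[OF matmul.has_vector_derivative[OF
      has_vector_derivative_mat_exp_scaleR has_vector_derivative_const]
      has_vector_derivative_mat_exp_scaleR]])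
      (simp add: bracket_def matmul.minus_right)
  have "c s = Ad (mat_exp (hat (s *\<^sub>R x))) (hat y)" for s
    by (simp add: c_def Ad_def matrix_inv_mat_exp linear_cmul[OF linear_hat])
  then have "c s \<in> range hat" for s by (simp add: Ad_in range_hat)
  moreover have "hat (L y) = y" if "y \<in> range hat" for y using that by (auto simp: L(2))
  ultimately have c: "(\<lambda>s. hat (L (c s))) = c" by blast
  have "bounded_linear (\<lambda>a. hat (L a))"
    using linear_compose[OF L(1) linear_hat] by (simp add: o_def linear_conv_bounded_linear)
  from bounded_linear.has_vector_derivative[OF this deriv]
  have "bracket (hat x) (hat y) = hat (L (bracket (hat x) (hat y)))"
    unfolding c by (rule vector_derivative_unique_at[OF deriv])
  then show ?thesis by (metis hat_in)
qed

text \<open>\<open>matrix\<close> represents a map only if it is linear; linearity of the bracket in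
  coordinates is checked after applying the injective \<open>hat\<close>.\<close>

lemma hat_adm: "hat (adm hat x *v y) = bracket (hat x) (hat y)"
proof -
  have eq: "hat (vee hat (bracket (hat x) (hat y))) = bracket (hat x) (hat y)" for y
    by (simp add: hat_vee bracket_in)
  have "linear (\<lambda>y. vee hat (bracket (hat x) (hat y)))"
    by (rule linearI; rule injD[OF inj_hat], simp_all only: eq,
        simp_all only: eq linear_add[OF linear_hat] linear_cmul[OF linear_hat])
      (simp_all add: bracket_def
        matmul.add_left matmul.add_right matmul.scaleR_left matmul.scaleR_right scaleR_diff_right)
  then show ?thesis by (simp add: adm_def matrix_works eq)
qed

text \<open>The sign of \<open>- x\<close> swaps the bracket: [- x, y] = [y, x]. Thus
  \<open>hat\<close> carries powers of \<open>adm hat (- x)\<close> to iterated right brackets, and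
  the two series agree term by term.\<close>

lemma hat_dexpm: "hat (dexpm hat (- x) *v h) = conj_integral (hat x) (hat h) 1"
proof -
  have pow: "hat (mat_pow (adm hat (- x)) k *v h) = ((\<lambda>B. bracket B (hat x)) ^^ k) (hat h)" for k
    by (induction k)
      (simp_all add: matrix_vector_mul_assoc[symmetric] hat_adm linear_neg[OF linear_hat]
        bracket_def matmul.minus_left matmul.minus_right)
  have "linear (\<lambda>M. hat (M *v h))"
    by (rule linearI) (simp_all add: matrix_vector_mult_add_rdistrib scaleR_matrix_vector_assoc[symmetric]
        linear_add[OF linear_hat] linear_cmul[OF linear_hat])
  from egf_linear_image[OF this geom_bounded_case_nat[OF geom_bounded_mat_pow]]
  have "hat (dexpm hat (- x) *v h) = egf (\<lambda>k. hat (case_nat 0 (mat_pow (adm hat (- x))) k *v h)) 1"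
    by (simp add: dexpm_eq_egf)
  also have "(\<lambda>k. hat (case_nat 0 (mat_pow (adm hat (- x))) k *v h)) =
      case_nat 0 (\<lambda>k. ((\<lambda>B. bracket B (hat x)) ^^ k) (hat h))"
    by (rule ext) (simp add: pow linear_0[OF linear_hat] split: nat.split)
  finally show ?thesis by (simp add: conj_integral_def)
qed

lemma has_derivative_mat_exp_hat:
  "((\<lambda>x. mat_exp (hat x)) has_derivative (\<lambda>h. mat_exp (hat x) ** hat (dexpm hat (- x) *v h))) (at x)"
  using diff_chain_at[OF linear_imp_has_derivative[OF linear_hat] has_derivative_mat_exp]
  by (simp add: o_def hat_dexpm)

text \<open>Integer multiples of the short vectors \<open>b k\<close> approximate every
  \<open>s *\<^sub>R c\<close> with \<open>s \<ge> 0\<close>, and their exponentials are powers of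
  group elements. Closedness puts exp (s c) in \<open>G\<close>; inverses give negative
  \<open>s\<close>.\<close>

lemma lie_algebra_of_limit_direction:
  assumes b0: "b \<longlonglongrightarrow> 0" and bG: "\<And>k. mat_exp (b k) \<in> G" and bnz: "\<And>k. b k \<noteq> 0"
    and c: "(\<lambda>k. b k /\<^sub>R norm (b k)) \<longlonglongrightarrow> c"
  shows "c \<in> lie_algebra G"
proof -
  have pos: "mat_exp (s *\<^sub>R c) \<in> G" if s: "s \<ge> 0" for s
  proof -
    \<comment> \<open>Rounding down costs at most one step of length \<open>norm (b k)\<close>,
      which tends to 0.\<close>
    define m where "m k = nat \<lfloor>s / norm (b k)\<rfloor>" for k
    have "norm (real (m k) * norm (b k) - s) \<le> norm (b k)" for k
    proof -
      have "real (m k) = of_int \<lfloor>s / norm (b k)\<rfloor>" using s by (simp add: m_def)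
      then have "real (m k) \<le> s / norm (b k)" "s / norm (b k) \<le> real (m k) + 1" by linarith+
      then show ?thesis using bnz[of k] by (simp add: field_simps abs_le_iff)
    qed
    then have "(\<lambda>k. real (m k) * norm (b k) - s) \<longlonglongrightarrow> 0"
      by (intro Lim_null_comparison[OF _ tendsto_norm_zero[OF b0]]) auto
    then have "(\<lambda>k. real (m k) * norm (b k)) \<longlonglongrightarrow> s" by (simp add: LIM_zero_iff)
    from tendsto_scaleR[OF this c] have "(\<lambda>k. real (m k) *\<^sub>R b k) \<longlonglongrightarrow> s *\<^sub>R c"
      by (simp add: bnz mult.assoc)
    then have "(\<lambda>k. mat_exp (real (m k) *\<^sub>R b k)) \<longlonglongrightarrow> mat_exp (s *\<^sub>R c)"
      using continuous_on_tendsto_compose[OF continuous_on_mat_exp[of UNIV]] by auto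
    then show ?thesis
      by (rule limit_in) (simp_all add: mat_exp_of_nat mat_pow_in bG invertible_mat_exp)
  qed
  have "mat_exp (s *\<^sub>R c) \<in> G" for s
    using pos[of s] mat_exp_minus_in[OF pos[of "- s"]] by (cases "s \<ge> 0") auto
  then show ?thesis unfolding lie_algebra_def tangent_space_def
  proof (intro CollectI exI[of _ "\<lambda>s. mat_exp (s *\<^sub>R c)"] exI[of _ 1] conjI ballI)
    show "(\<lambda>s. mat_exp (s *\<^sub>R c)) differentiable at s" for s
      using has_vector_derivative_mat_exp_scaleR differentiableI_vector by blast
    show "((\<lambda>s. mat_exp (s *\<^sub>R c)) has_vector_derivative c) (at 0)"
      using has_vector_derivative_mat_exp_scaleR[of c 0 UNIV] by simp
  qed auto
qed

text \<open>This is the crucial step of the closed subgroup theorem: a sequence of exceptions, normalised,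
  would accumulate at a direction that lies in the Lie algebra as well as in the complement.\<close>
lemma mat_exp_complement_not_in:
  assumes L: "linear L" "\<And>x. L (hat x) = x"
  obtains e where "e > 0" "\<And>b. L b = 0 \<Longrightarrow> norm b < e \<Longrightarrow> mat_exp b \<in> G \<Longrightarrow> b = 0"
proof -
  have "\<exists>e>0. \<forall>b. L b = 0 \<longrightarrow> norm b < e \<longrightarrow> mat_exp b \<in> G \<longrightarrow> b = 0"
  proof (rule ccontr)
    assume "\<not> ?thesis"
    then have "\<exists>b. L b = 0 \<and> norm b < inverse (real (Suc k)) \<and> mat_exp b \<in> G \<and> b \<noteq> 0" for k
      by (metis inverse_positive_iff_positive of_nat_0_less_iff zero_less_Suc)
    then obtain b where b: "\<And>k. L (b k) = 0" "\<And>k. norm (b k) < inverse (real (Suc k))"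
      "\<And>k. mat_exp (b k) \<in> G" "\<And>k. b k \<noteq> 0"
      by metis
    have b0: "b \<longlonglongrightarrow> 0"
      by (rule Lim_null_comparison[OF _ LIMSEQ_inverse_real_of_nat])
        (use b(2) in \<open>intro always_eventually allI less_imp_le\<close>)
    have sphere: "\<forall>k. b k /\<^sub>R norm (b k) \<in> sphere 0 1" using b(4) by simp
    obtain c r where c: "c \<in> sphere 0 1" "strict_mono r"
      "((\<lambda>k. b k /\<^sub>R norm (b k)) \<circ> r) \<longlonglongrightarrow> c"
      using compact_imp_seq_compact[OF compact_sphere] sphere by (rule seq_compactE)
    have "c \<in> lie_algebra G"
      by (rule lie_algebra_of_limit_direction[of "b \<circ> r"])
        (use LIMSEQ_subseq_LIMSEQ[OF b0 c(2)] c(3) b(3,4) in \<open>simp_all add: o_def\<close>)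
    then obtain x where x: "c = hat x" unfolding range_hat[symmetric] by blast
    have "(\<lambda>k. L (b (r k) /\<^sub>R norm (b (r k)))) \<longlonglongrightarrow> L c"
      using bounded_linear.tendsto[OF linear_conv_bounded_linear[THEN iffD1, OF L(1)] c(3)]
      by (simp add: o_def)
    then have "(\<lambda>k. 0) \<longlonglongrightarrow> L c" by (simp add: linear_cmul[OF L(1)] b)
    then have "L c = 0" by (simp add: LIMSEQ_const_iff)
    then have "c = 0" using x L(2) linear_0[OF linear_hat] by simp
    then show False using c(1) by simp
  qed
  then show ?thesis using that by blast
qed

end

subsection \<open>Derivatives of inverses\<close>

lemma has_vector_derivative_iff_quotient:
  "(f has_vector_derivative D) (at x within S) \<longleftrightarrow>
    ((\<lambda>y. (f y - f x) /\<^sub>R (y - x)) \<longlongrightarrow> D) (at x within S)"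
proof -
  have "norm (f y - f x - (y - x) *\<^sub>R D) / norm (y - x) = norm ((f y - f x) /\<^sub>R (y - x) - D)"
    if "y \<noteq> x" for y
  proof -
    have "(f y - f x) /\<^sub>R (y - x) - D = (f y - f x - (y - x) *\<^sub>R D) /\<^sub>R (y - x)"
      using that by (simp add: scaleR_diff_right)
    then show ?thesis by (simp add: divide_inverse mult.commute)
  qed
  then have "((\<lambda>y. norm (f y - f x - (y - x) *\<^sub>R D) / norm (y - x)) \<longlongrightarrow> 0) (at x within S) \<longleftrightarrow>
      ((\<lambda>y. norm ((f y - f x) /\<^sub>R (y - x) - D)) \<longlongrightarrow> 0) (at x within S)"
    by (intro Lim_cong_within) auto
  then show ?thesis
    by (simp add: has_vector_derivative_def has_derivative_iff_norm bounded_linear_scaleR_left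
        tendsto_norm_zero_iff LIM_zero_iff)
qed

text \<open>Resolvent identity: the difference of inverses is - Z (X - A) B with Z, B the inverses
  of X, A. Its norm involves Z itself; once \<open>c s < 1 / 2\<close> that term is absorbed on the
  left and Z is bounded.\<close>

lemma tendsto_matrix_inv:
  fixes X :: "'a \<Rightarrow> real ^ 'n ^ 'n"
  assumes X: "(X \<longlongrightarrow> A) F" and inv: "\<forall>\<^sub>F s in F. invertible (X s)" and A: "invertible A"
  shows "((\<lambda>s. matrix_inv (X s)) \<longlongrightarrow> matrix_inv A) F"
proof -
  let ?Z = "\<lambda>s. matrix_inv (X s)" and ?B = "matrix_inv A"
  obtain k :: real where k: "k > 0"
    "\<And>(A :: real ^ 'n ^ 'n) (B :: real ^ 'n ^ 'n). norm (A ** B) \<le> norm A * norm B * k"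
    using matmul.pos_bounded by blast
  define c where "c s = norm (X s - A) * norm ?B * k * k" for s
  have c0: "(c \<longlongrightarrow> 0) F"
    unfolding c_def using X by (intro tendsto_mult_left_zero tendsto_norm_zero) (simp add: LIM_zero)
  have diff: "norm (?Z s - ?B) \<le> norm (?Z s) * c s" if "invertible (X s)" for s
  proof -
    have "?Z s - ?B = - (?Z s ** ((X s - A) ** ?B))"
      by (simp add: matmul.diff_left matmul.diff_right matrix_inv_right[OF A])
        (simp add: matrix_mul_assoc matrix_inv_left[OF that])
    then have "norm (?Z s - ?B) \<le> norm (?Z s) * norm ((X s - A) ** ?B) * k"
      using k(2)[of "?Z s" "(X s - A) ** ?B"] by simp
    also have "\<dots> \<le> norm (?Z s) * (norm (X s - A) * norm ?B * k) * k"
      using k by (intro mult_right_mono mult_left_mono) auto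
    finally show ?thesis by (simp add: c_def mult_ac)
  qed
  have "\<forall>\<^sub>F s in F. c s < 1 / 2" using order_tendstoD(2)[OF c0, of "1 / 2"] by simp
  then have "\<forall>\<^sub>F s in F. norm (?Z s - ?B) \<le> 2 * norm ?B * c s"
    using inv
  proof eventually_elim
    case (elim s)
    have c: "0 \<le> c s" using k by (simp add: c_def)
    have "norm (?Z s) \<le> norm ?B + norm (?Z s - ?B)" by (metis norm_triangle_sub add.commute)
    also have "\<dots> \<le> norm ?B + norm (?Z s) * (1 / 2)"
      using diff[OF elim(2)] elim(1) mult_left_mono[of "c s" "1 / 2" "norm (?Z s)"] by simp
    finally have "norm (?Z s) \<le> 2 * norm ?B" by simp
    from mult_right_mono[OF this c] show ?case using diff[OF elim(2)] by simp
  qed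
  moreover have "((\<lambda>s. 2 * norm ?B * c s) \<longlongrightarrow> 0) F" using c0 by (rule tendsto_mult_right_zero)
  ultimately have "((\<lambda>s. ?Z s - ?B) \<longlongrightarrow> 0) F" by (rule Lim_null_comparison)
  then show ?thesis by (simp add: LIM_zero_iff)
qed

lemma has_vector_derivative_matrix_inv:
  fixes X :: "real \<Rightarrow> real ^ 'n ^ 'n"
  assumes X: "(X has_vector_derivative X') (at t within S)" and t: "t \<in> S"
    and inv: "\<And>s. s \<in> S \<Longrightarrow> invertible (X s)"
  shows "((\<lambda>s. matrix_inv (X s)) has_vector_derivative - (matrix_inv (X t) ** X' ** matrix_inv (X t)))
    (at t within S)"
proof -
  let ?Z = "\<lambda>s. matrix_inv (X s)"
  have ev: "\<forall>\<^sub>F s in at t within S. invertible (X s)"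
    using inv by (simp add: eventually_at_filter)
  have Z: "(?Z \<longlongrightarrow> ?Z t) (at t within S)"
    using has_vector_derivative_continuous[OF X]
    by (intro tendsto_matrix_inv ev inv t) (simp add: continuous_within)
  have "((\<lambda>s. - (?Z s ** ((X s - X t) /\<^sub>R (s - t)) ** ?Z t)) \<longlongrightarrow> - (?Z t ** X' ** ?Z t)) (at t within S)"
    using X by (intro tendsto_minus matmul.tendsto Z tendsto_const)
      (simp add: has_vector_derivative_iff_quotient)
  moreover have "\<forall>\<^sub>F s in at t within S.
      - (?Z s ** ((X s - X t) /\<^sub>R (s - t)) ** ?Z t) = (?Z s - ?Z t) /\<^sub>R (s - t)"
    using ev
  proof eventually_elim
    case (elim s)
    have "?Z s ** (X s - X t) ** ?Z t = ?Z t - ?Z s"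
      by (simp add: matmul.diff_left matmul.diff_right matrix_inv_left[OF elim])
        (simp add: matrix_mul_assoc[symmetric] matrix_inv_right[OF inv[OF t]])
    then show ?case
      by (simp add: matmul.scaleR_left matmul.scaleR_right flip: scaleR_minus_right)
  qed
  ultimately show ?thesis
    by (simp add: has_vector_derivative_iff_quotient Lim_transform_eventually)
qed

text \<open>Only continuity of \<xi> at \<open>t\<close> is given. Applying \<open>Q\<close> turns F
  into the identity up to a remainder small relative to \<xi> s - \<xi> t; when the ratio \<rho> is
  below 1/2, the unknown difference quotient is bounded by the known \<open>q\<close>, and the
  remainder vanishes in the limit.\<close>

lemma has_vector_derivative_left_inverse:
  fixes F :: "'a::real_normed_vector \<Rightarrow> 'b::real_normed_vector"
  assumes F: "(F has_derivative F') (at (\<xi> t))" and Q: "bounded_linear Q" "\<And>h. Q (F' h) = h"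
    and \<xi>: "(\<xi> \<longlongrightarrow> \<xi> t) (at t within S)"
    and curve: "((\<lambda>s. F (\<xi> s)) has_vector_derivative v) (at t within S)"
  shows "(\<xi> has_vector_derivative Q v) (at t within S)"
proof -
  interpret Q: bounded_linear Q by fact
  let ?A = "at t within S"
  define R where "R y = Q (F y - F (\<xi> t)) - (y - \<xi> t)" for y
  define \<rho> where "\<rho> s = norm (R (\<xi> s)) / norm (\<xi> s - \<xi> t)" for s
  define q where "q s = (Q (F (\<xi> s)) - Q (F (\<xi> t))) /\<^sub>R (s - t)" for s
  have "((\<lambda>y. Q (F y)) has_derivative (\<lambda>h. h)) (at (\<xi> t))"
    using Q.has_derivative[OF F] by (simp add: Q(2))
  then have "(\<lambda>y. norm (R y) / norm (y - \<xi> t)) \<midarrow>\<xi> t\<rightarrow> 0"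
    by (simp add: has_derivative_iff_norm R_def Q.diff)
  \<comment> \<open>At \<xi> t the quotient is 0 / 0 = 0, so the punctured limit is continuity, and
    times with \<xi> s = \<xi> t need no separate treatment.\<close>
  then have "isCont (\<lambda>y. norm (R y) / norm (y - \<xi> t)) (\<xi> t)"
    by (simp add: isCont_def)
  from isCont_tendsto_compose[OF this \<xi>] have \<rho>: "(\<rho> \<longlongrightarrow> 0) ?A"
    by (simp add: \<rho>_def[abs_def])
  have q: "(q \<longlongrightarrow> Q v) ?A"
    using Q.has_vector_derivative[OF curve] unfolding q_def has_vector_derivative_iff_quotient .
  have R: "norm (R (\<xi> s)) = \<rho> s * norm (\<xi> s - \<xi> t)" for s
    by (cases "\<xi> s = \<xi> t") (auto simp: \<rho>_def R_def)
  have eq: "(\<xi> s - \<xi> t) /\<^sub>R (s - t) = q s - R (\<xi> s) /\<^sub>R (s - t)" for s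
    by (simp add: q_def R_def Q.diff scaleR_diff_right)
  have "\<forall>\<^sub>F s in ?A. \<rho> s < 1 / 2" using order_tendstoD(2)[OF \<rho>, of "1 / 2"] by simp
  then have "\<forall>\<^sub>F s in ?A. norm (R (\<xi> s) /\<^sub>R (s - t)) \<le> \<rho> s * (2 * norm (q s))"
  proof eventually_elim
    case (elim s)
    let ?d = "norm ((\<xi> s - \<xi> t) /\<^sub>R (s - t))"
    have \<rho>0: "\<rho> s \<ge> 0" by (simp add: \<rho>_def)
    have n: "norm (R (\<xi> s) /\<^sub>R (s - t)) = \<rho> s * ?d" by (simp add: R)
    have "?d \<le> norm (q s) + \<rho> s * ?d" unfolding n[symmetric] unfolding eq by (rule norm_triangle_ineq4)
    moreover have "\<rho> s * ?d \<le> 1 / 2 * ?d" using elim by (intro mult_right_mono) auto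
    ultimately have "?d \<le> 2 * norm (q s)" by linarith
    then show ?case unfolding n by (rule mult_left_mono) (rule \<rho>0)
  qed
  moreover have "((\<lambda>s. \<rho> s * (2 * norm (q s))) \<longlongrightarrow> 0) ?A"
    using tendsto_mult[OF \<rho> tendsto_mult[OF tendsto_const tendsto_norm[OF q]], of 2] by simp
  ultimately have "((\<lambda>s. R (\<xi> s) /\<^sub>R (s - t)) \<longlongrightarrow> 0) ?A" by (rule Lim_null_comparison)
  from tendsto_diff[OF q this] show ?thesis
    by (simp add: has_vector_derivative_iff_quotient eq)
qed

lemma conj_integral_0_left: "conj_integral 0 H s = s *\<^sub>R H"
proof -
  have "((\<lambda>s. conj_integral 0 H s - s *\<^sub>R H) has_vector_derivative 0) (at s)" for s
    by (rule has_vector_derivative_eq_rhs[OF has_vector_derivative_diff[OF has_vector_derivative_conj_integral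
          has_vector_derivative_scaleR[OF DERIV_ident has_vector_derivative_const]]]) simp
  from has_vector_derivative_zero_eq[of "\<lambda>s. conj_integral 0 H s - s *\<^sub>R H", OF this, of s 0]
  show ?thesis by simp
qed

lemma has_derivative_mat_exp_0: "(mat_exp has_derivative (\<lambda>H. H)) (at 0)"
  using has_derivative_mat_exp[of 0] by (simp add: conj_integral_0_left)

subsection \<open>The logarithmic error\<close>

context lie_group_chart
begin

lemma exp_logm: "Y \<in> V \<Longrightarrow> mat_exp (hat (logm Y)) = Y"
  using logm by (auto simp: local_log_def expm_def)

text \<open>\<open>M - hat (L M)\<close> projects onto the kernel of \<open>L\<close> along the Lie
  algebra. Letting \<open>M\<close> range over all matrices keeps the domain a Euclidean space; the
  excess dimensions are harmless, as the open mapping step asks only for a right inverse of the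
  derivative.\<close>

lemma has_derivative_exp_chart:
  fixes L :: "real ^ 'n ^ 'n \<Rightarrow> real ^ 'd"
  assumes L: "linear L"
  shows "((\<lambda>p. mat_exp (hat (fst p)) ** mat_exp (snd p - hat (L (snd p)))) has_derivative
    (\<lambda>p. mat_exp (hat x) ** (snd p - hat (L (snd p))) + mat_exp (hat x) ** hat (dexpm hat (- x) *v fst p)))
    (at (x, 0))"
proof -
  have "((\<lambda>M. M - hat (L M)) has_derivative (\<lambda>M. M - hat (L M))) (at 0)"
    by (intro linear_imp_has_derivative linear_compose_sub linear_id[unfolded id_def]
        linear_compose[OF L linear_hat, unfolded o_def])
  moreover have "(mat_exp has_derivative (\<lambda>H. H)) (at (0 - hat (L 0)))"
    by (simp add: has_derivative_mat_exp_0 linear_0[OF L] linear_0[OF linear_hat])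
  ultimately have right: "((\<lambda>M. mat_exp (M - hat (L M))) has_derivative (\<lambda>M. M - hat (L M))) (at 0)"
    using diff_chain_at[of "\<lambda>M. M - hat (L M)" _ 0 mat_exp "\<lambda>H. H"] by (simp add: o_def)
  have "((\<lambda>p. mat_exp (hat (fst p))) has_derivative
      (\<lambda>p. mat_exp (hat x) ** hat (dexpm hat (- x) *v fst p))) (at (x, 0 :: real ^ 'n ^ 'n))"
    using diff_chain_at[OF bounded_linear_imp_has_derivative[OF bounded_linear_fst], of _ _ "(x, 0)"]
      has_derivative_mat_exp_hat[of x] by (simp add: o_def)
  moreover have "((\<lambda>p. mat_exp (snd p - hat (L (snd p)))) has_derivative
      (\<lambda>p. snd p - hat (L (snd p)))) (at (x, 0 :: real ^ 'n ^ 'n))"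
    using diff_chain_at[OF bounded_linear_imp_has_derivative[OF bounded_linear_snd], of _ _ "(x, 0)"]
      right by (simp add: o_def)
  ultimately show ?thesis
    using matmul.FDERIV[of "\<lambda>p. mat_exp (hat (fst p))" _ "(x, 0)" UNIV
        "\<lambda>p. mat_exp (snd p - hat (L (snd p)))"]
    by (simp add: linear_0[OF L] linear_0[OF linear_hat])
qed

text \<open>Continuity of \<open>logm\<close> is obtained from the open mapping theorem for the chart of the previous
  lemma: a point of \<open>G\<close> near \<open>exp x\<close> has the form \<open>exp x' exp b\<close> with \<open>b\<close> small in the complement,
  and then \<open>b = 0\<close>.\<close>
lemma tendsto_logm:
  assumes Y: "(Y \<longlongrightarrow> A) F" "\<forall>\<^sub>F s in F. Y s \<in> V" and A: "A \<in> V"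
    and inv: "invertible (dexpm hat (- logm A))"
  shows "((\<lambda>s. logm (Y s)) \<longlongrightarrow> logm A) F"
proof (rule tendstoI)
  fix r :: real assume r: "r > 0"
  obtain W where W: "open W" "\<And>x. x \<in> W \<Longrightarrow> logm (mat_exp (hat x)) = x"
    "\<And>B. B \<in> V \<Longrightarrow> logm B \<in> W \<and> mat_exp (hat (logm B)) = B"
    using logm unfolding local_log_def expm_def by blast
  have VG: "V \<subseteq> G" using logm openin_imp_subset unfolding local_log_def by blast
  obtain L where L: "linear L" "\<And>x. L (hat x) = x" by (rule left_inverse_hat) blast
  obtain e where e: "e > 0" "\<And>b. L b = 0 \<Longrightarrow> norm b < e \<Longrightarrow> mat_exp b \<in> G \<Longrightarrow> b = 0"
    using mat_exp_complement_not_in[OF L] by blast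
  define x where "x = logm A"
  define \<Phi> where "\<Phi> p = mat_exp (hat (fst p)) ** mat_exp (snd p - hat (L (snd p)))"
    for p :: "(real ^ 'd) \<times> (real ^ 'n ^ 'n)"
  define D where "D = dexpm hat (- x)"
  define \<Phi>' where "\<Phi>' p = mat_exp (hat x) ** (snd p - hat (L (snd p))) + mat_exp (hat x) ** hat (D *v fst p)"
    for p :: "(real ^ 'd) \<times> (real ^ 'n ^ 'n)"
  \<comment> \<open>The right inverse of \<Phi>': translate back to the identity, split off the Lie
    algebra part with \<open>L\<close>, and undo \<open>D\<close> on that part.\<close>
  define g' where "g' N = (matrix_inv D *v L (mat_exp (- hat x) ** N),
    mat_exp (- hat x) ** N - hat (L (mat_exp (- hat x) ** N)))" for N
  \<comment> \<open>The ball gives the wanted closeness, \<open>W\<close> makes \<open>logm\<close>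
    undo the exponential, and the bound \<open>e\<close> forces the complement part to vanish on
    \<open>G\<close>.\<close>
  define T where "T = (ball x r \<inter> W) \<times> {M. norm (M - hat (L M)) < e}"
  note [continuous_intros] = linear_continuous_on_compose[OF _ L(1)] linear_continuous_on_compose[OF _ linear_hat]
    continuous_on_compose2[OF continuous_on_mat_exp[of UNIV]]
    matmul.continuous_on
  have \<Phi>: "(\<Phi> has_derivative \<Phi>') (at (x, 0))"
    using has_derivative_exp_chart[OF L(1)] by (simp add: \<Phi>_def[abs_def] \<Phi>'_def[abs_def] D_def)
  have cont: "continuous_on UNIV \<Phi>"
    unfolding \<Phi>_def by (intro continuous_intros) auto
  have "linear g'"
    unfolding g'_def
    by (rule linearI) (simp_all add: linear_add[OF L(1)] linear_cmul[OF L(1)] linear_add[OF linear_hat]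
        linear_cmul[OF linear_hat] matmul.add_right matmul.scaleR_right matrix_vector_right_distrib
        matrix_vector_mult_scaleR scaleR_diff_right)
  then have g': "bounded_linear g'" by (simp add: linear_conv_bounded_linear)
  have "\<Phi>' (g' N) = N" for N
  proof -
    have "D *v (matrix_inv D *v y) = y" for y
      using matrix_inv_right[of D] inv by (simp add: D_def x_def matrix_vector_mul_assoc)
    then have "\<Phi>' (g' N) = mat_exp (hat x) ** (mat_exp (- hat x) ** N)"
      by (simp add: \<Phi>'_def g'_def linear_diff[OF L(1)] L(2) linear_0[OF linear_hat] matmul.diff_right)
    then show ?thesis by (simp add: matrix_mul_assoc mat_exp_minus_right)
  qed
  then have id: "\<Phi>' \<circ> g' = id" by auto
  have "open {M. norm (M - hat (L M)) < e}"
    by (intro open_Collect_less continuous_intros)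
  then have T: "open T" unfolding T_def by (intro open_Times open_Int W(1)) auto
  have "(x, 0) \<in> T"
    using W(3)[OF A] e(1) r by (simp add: T_def x_def linear_0[OF L(1)] linear_0[OF linear_hat])
  then have "\<Phi> (x, 0) \<in> interior (\<Phi> ` T)"
    by (intro sussmann_open_mapping[OF open_UNIV cont _ \<Phi> g' id]) (auto simp: interior_open[OF T])
  moreover have "\<Phi> (x, 0) = A"
    using W(3)[OF A] by (simp add: \<Phi>_def x_def linear_0[OF L(1)] linear_0[OF linear_hat])
  ultimately have "\<forall>\<^sub>F s in F. Y s \<in> interior (\<Phi> ` T)"
    using topological_tendstoD[OF Y(1) open_interior] by simp
  then show "\<forall>\<^sub>F s in F. dist (logm (Y s)) (logm A) < r"
    using Y(2)
  proof eventually_elim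
    case (elim s)
    then obtain y M where yM: "y \<in> ball x r" "y \<in> W" "norm (M - hat (L M)) < e"
      "Y s = mat_exp (hat y) ** mat_exp (M - hat (L M))"
      using interior_subset unfolding T_def \<Phi>_def by fastforce
    have "mat_exp (hat (- y)) ** Y s \<in> G"
      using elim VG by (intro mult_in mat_exp_hat_in) auto
    also have "mat_exp (hat (- y)) ** Y s = mat_exp (M - hat (L M))"
      unfolding yM(4) by (simp add: linear_neg[OF linear_hat] matrix_mul_assoc mat_exp_minus_left)
    finally have "M - hat (L M) = 0"
      using yM(3) by (intro e(2)) (simp_all add: linear_diff[OF L(1)] L(2))
    then have "logm (Y s) = y" using yM by (simp add: W(2))
    then show ?case using yM(1) by (simp add: x_def dist_commute)
  qed
qed

lemma has_vector_derivative_logm: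
  assumes t: "t \<in> S" and \<eta>V: "\<And>s. s \<in> S \<Longrightarrow> \<eta> s \<in> V"
    and \<eta>: "(\<eta> has_vector_derivative \<eta> t ** hat v) (at t within S)"
    and inv: "invertible (dexpm hat (- logm (\<eta> t)))"
  shows "((\<lambda>s. logm (\<eta> s)) has_vector_derivative matrix_inv (dexpm hat (- logm (\<eta> t))) *v v)
    (at t within S)"
proof -
  define D where "D = dexpm hat (- logm (\<eta> t))"
  have exp_log: "mat_exp (hat (logm (\<eta> s))) = \<eta> s" if "s \<in> S" for s
    by (rule exp_logm[OF \<eta>V[OF that]])
  obtain L where L: "linear L" "\<And>x. L (hat x) = x" by (rule left_inverse_hat) blast
  \<comment> \<open>\<open>Q\<close> inverts the derivative of exp on its range: it translates back
    by the inverse of \<eta> t, reads coordinates with \<open>L\<close> and removes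
    \<open>D\<close>.\<close>
  define Q where "Q N = matrix_inv D *v L (mat_exp (- hat (logm (\<eta> t))) ** N)" for N
  have D: "matrix_inv D *v (D *v y) = y" for y
    using matrix_inv_left[of D] inv by (simp add: D_def matrix_vector_mul_assoc)
  have Q_mult: "Q (\<eta> t ** hat y) = matrix_inv D *v y" for y
    using mat_exp_minus_left[of "hat (logm (\<eta> t))"]
    by (simp add: Q_def exp_log[OF t] matrix_mul_assoc L(2))
  have "((\<lambda>s. logm (\<eta> s)) has_vector_derivative Q (\<eta> t ** hat v)) (at t within S)"
  proof (rule has_vector_derivative_left_inverse[where F = "\<lambda>x. mat_exp (hat x)"
        and F' = "\<lambda>h. \<eta> t ** hat (D *v h)"])
    show "((\<lambda>x. mat_exp (hat x)) has_derivative (\<lambda>h. \<eta> t ** hat (D *v h))) (at (logm (\<eta> t)))"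
      using has_derivative_mat_exp_hat[of "logm (\<eta> t)"] by (simp add: exp_log[OF t] D_def)
    have "linear Q"
      unfolding Q_def
      by (rule linearI) (simp_all add: linear_add[OF L(1)] linear_cmul[OF L(1)] matmul.add_right
          matmul.scaleR_right matrix_vector_right_distrib matrix_vector_mult_scaleR)
    then show "bounded_linear Q" by (simp add: linear_conv_bounded_linear)
    show "Q (\<eta> t ** hat (D *v h)) = h" for h by (simp add: Q_mult D)
    show "((\<lambda>s. logm (\<eta> s)) \<longlongrightarrow> logm (\<eta> t)) (at t within S)"
      using has_vector_derivative_continuous[OF \<eta>] \<eta>V
      by (intro tendsto_logm \<eta>V t inv) (auto simp: continuous_within eventually_at_filter)
    show "((\<lambda>s. mat_exp (hat (logm (\<eta> s)))) has_vector_derivative \<eta> t ** hat v) (at t within S)"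
      by (rule has_vector_derivative_transform[OF t exp_log \<eta>])
  qed
  then show ?thesis unfolding Q_mult D_def .
qed

text \<open>Along the one-parameter group of \<open>x\<close>, the function \<open>c s = exp (- s x) g (exp (s x))\<close> is a
  cocycle, so that its derivative at \<open>0\<close> determines it completely.\<close>
lemma log_linear:
  assumes g_mult: "\<And>X Y. X \<in> G \<Longrightarrow> Y \<in> G \<Longrightarrow> g (X ** Y) = g X ** Y + X ** g Y"
    and g_tangent: "\<And>X. X \<in> G \<Longrightarrow> matrix_inv X ** g X \<in> lie_algebra G"
    and A: "is_error_differential hat g A"
  shows "g (mat_exp (hat x)) = mat_exp (hat x) ** hat (dexpm hat (- x) *v (A *v x))"
proof -
  define E where "E s = mat_exp (s *\<^sub>R hat x)" for s
  have E_hat: "E s = mat_exp (hat (s *\<^sub>R x))" for s by (simp add: E_def linear_cmul[OF linear_hat])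
  have EG: "E s \<in> G" for s unfolding E_hat by simp
  have Em: "matrix_inv (E s) = E (- s)" for s by (simp add: E_def matrix_inv_mat_exp)
  have E_add: "E (r + s) = E r ** E s" for r s by (simp add: E_def mat_exp_add_scaleR)
  have E0: "E 0 = mat 1" by (simp add: E_def)
  have E_cancel: "E (- s) ** E s = mat 1" "E s ** E (- s) = mat 1" for s
    by (simp_all flip: E_add add: E0)
  define c where "c s = E (- s) ** g (E s)" for s
  \<comment> \<open>The sum is split with \<open>r\<close> first, so that the conjugation is by
    \<open>E s\<close> alone and the derivative of \<open>c\<close> at 0 can be transported to
    \<open>s\<close>.\<close>
  have c_add: "c (s + r) = E (- s) ** c r ** E s + c s" for s r
  proof -
    have "c (s + r) = (E (- s) ** E (- r)) ** g (E r ** E s)"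
      by (simp add: c_def add.commute flip: E_add)
    also have "\<dots> = E (- s) ** (E (- r) ** g (E r)) ** E s + E (- s) ** (E (- r) ** E r) ** g (E s)"
      by (simp add: g_mult EG matmul.add_right matrix_mul_assoc)
    finally show ?thesis by (simp add: c_def E_cancel)
  qed
  have "((\<lambda>s. hat (vee hat (matrix_inv (expm hat (s *\<^sub>R x)) ** g (expm hat (s *\<^sub>R x)))))
      has_vector_derivative hat (A *v x)) (at 0)"
  proof -
    have "((\<lambda>s. s *\<^sub>R x) has_derivative (\<lambda>s. s *\<^sub>R x)) (at 0)"
      by (intro bounded_linear_imp_has_derivative bounded_linear_scaleR_left)
    from diff_chain_at[OF this, of "\<lambda>y. vee hat (matrix_inv (expm hat y) ** g (expm hat y))" "(*v) A"]
    have "((\<lambda>s. vee hat (matrix_inv (expm hat (s *\<^sub>R x)) ** g (expm hat (s *\<^sub>R x))))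
        has_vector_derivative A *v x) (at 0)"
      using A by (simp add: is_error_differential_def has_vector_derivative_def o_def
          matrix_vector_mult_scaleR)
    from bounded_linear.has_vector_derivative[OF linear_conv_bounded_linear[THEN iffD1, OF linear_hat] this]
    show ?thesis .
  qed
  \<comment> \<open>\<open>g_tangent\<close> is what makes \<open>hat\<close> undo
    \<open>vee\<close> here; off the Lie algebra the value of \<open>vee\<close> carries no
    information.\<close>
  moreover have "hat (vee hat (matrix_inv (expm hat (s *\<^sub>R x)) ** g (expm hat (s *\<^sub>R x)))) = c s" for s
    using hat_vee[OF g_tangent[OF EG]] by (simp add: expm_def c_def flip: E_hat Em)
  ultimately have c0: "(c has_vector_derivative hat (A *v x)) (at 0)" by simp
  have c: "(c has_vector_derivative E (- s) ** hat (A *v x) ** E s) (at s)" for s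
  proof -
    have "((\<lambda>y. y - s) has_vector_derivative 1) (at s)"
      by (auto intro!: derivative_eq_intros)
    from vector_diff_chain_at[OF this, of c "hat (A *v x)"] c0
    have "((\<lambda>y. c (y - s)) has_vector_derivative hat (A *v x)) (at s)" by (simp add: o_def)
    from has_vector_derivative_add[OF bounded_linear.has_vector_derivative[OF matmul.bounded_linear_left
          bounded_linear.has_vector_derivative[OF matmul.bounded_linear_right this]] has_vector_derivative_const]
    have "((\<lambda>y. E (- s) ** c (y - s) ** E s + c s) has_vector_derivative
        E (- s) ** hat (A *v x) ** E s) (at s)"
      by simp
    then show ?thesis by (simp flip: c_add)
  qed
  have "((\<lambda>s. c s - conj_integral (hat x) (hat (A *v x)) s) has_vector_derivative 0) (at s)" for s
    using has_vector_derivative_diff[OF c has_vector_derivative_conj_integral[of "hat x" "hat (A *v x)" s]]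
    by (simp add: E_def)
  from has_vector_derivative_zero_eq[of "\<lambda>s. c s - conj_integral (hat x) (hat (A *v x)) s", OF this, of 1 0]
  have "c 1 - conj_integral (hat x) (hat (A *v x)) 1 = c 0" by simp
  \<comment> \<open>The Leibniz rule at the identity reads g 1 = g 1 + g 1.\<close>
  moreover have "c 0 = 0" using g_mult[of "mat 1" "mat 1"] by (simp add: c_def E0)
  ultimately have "c 1 = hat (dexpm hat (- x) *v (A *v x))" by (simp add: hat_dexpm)
  then have "E 1 ** (E (- 1) ** g (E 1)) = E 1 ** hat (dexpm hat (- x) *v (A *v x))"
    by (simp add: c_def)
  then show ?thesis unfolding matrix_mul_assoc E_cancel by (simp add: E_def)
qed

text \<open>The common form of both errors: \<open>v\<close> is \<open>w t\<close> on the left and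
  \<open>Ad_vec hat (Xh t) (w t)\<close> on the right. By \<open>log_linear\<close> the drift
  already contains the factor \<open>dexpm hat (- \<xi> t)\<close>, so inverting it leaves
  \<open>A *v \<xi> t\<close>.\<close>

lemma log_error_derivative:
  assumes t: "t \<in> S" and \<eta>V: "\<And>s. s \<in> S \<Longrightarrow> \<eta> s \<in> V"
    and \<eta>: "(\<eta> has_vector_derivative g (\<eta> t) + \<eta> t ** hat v) (at t within S)"
    and g_mult: "\<And>X Y. X \<in> G \<Longrightarrow> Y \<in> G \<Longrightarrow> g (X ** Y) = g X ** Y + X ** g Y"
    and g_tangent: "\<And>X. X \<in> G \<Longrightarrow> matrix_inv X ** g X \<in> lie_algebra G"
    and A: "is_error_differential hat g A"
    and \<xi>: "\<And>s. s \<in> S \<Longrightarrow> \<xi> s = logm (\<eta> s)"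
    and inv: "invertible (dexpm hat (- \<xi> t))"
  shows "(\<xi> has_vector_derivative matrix_inv (dexpm hat (- \<xi> t)) *v v + A *v \<xi> t) (at t within S)"
proof -
  let ?D = "dexpm hat (- \<xi> t)"
  have "mat_exp (hat (\<xi> t)) = \<eta> t"
    by (simp add: exp_logm \<eta>V \<xi> t)
  with log_linear[OF g_mult g_tangent A, of "\<xi> t"]
  have "g (\<eta> t) + \<eta> t ** hat v = \<eta> t ** hat (?D *v (A *v \<xi> t) + v)"
    by (simp add: linear_add[OF linear_hat] matmul.add_right)
  with \<eta> inv have "((\<lambda>s. logm (\<eta> s)) has_vector_derivative
      matrix_inv ?D *v (?D *v (A *v \<xi> t) + v)) (at t within S)"
    using has_vector_derivative_logm[OF t \<eta>V] \<xi>[OF t] by simp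
  moreover have "matrix_inv ?D *v (?D *v (A *v \<xi> t) + v) = matrix_inv ?D *v v + A *v \<xi> t"
    using matrix_inv_left[OF inv]
    by (simp add: matrix_vector_right_distrib matrix_vector_mul_assoc matrix_mul_assoc)
  ultimately show ?thesis
    using has_vector_derivative_transform[OF t \<xi>] by simp
qed

end

section \<open>The left- and right-invariant errors of an affine group system\<close>

theorem theorem2:
  fixes G V :: "(real ^ 'n ^ 'n) set"
    and hat :: "real ^ 'd \<Rightarrow> real ^ 'n ^ 'n"
    and logm :: "real ^ 'n ^ 'n \<Rightarrow> real ^ 'd"
    and U :: "(real ^ 'd) set"
    and f :: "real ^ 'd \<Rightarrow> real ^ 'n ^ 'n \<Rightarrow> real ^ 'n ^ 'n"
    and u w \<xi>L \<xi>R :: "real \<Rightarrow> real ^ 'd"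
    and X Xh \<eta>L \<eta>R :: "real \<Rightarrow> real ^ 'n ^ 'n"
    and AL AR :: "real \<Rightarrow> real ^ 'd ^ 'd"
    and t0 :: real and T :: ereal and I :: "real set"
  assumes G: "matrix_lie_group G"
    and hat: "lie_algebra_iso G hat"
    and logm: "local_log G hat V logm"
    and f: "affine_group_system G U f"
    and T: "ereal t0 < T"
    and I: "I = time_interval t0 T"
    and u: "\<And>t. t \<in> I \<Longrightarrow> u t \<in> U"
    and w: "w differentiable_on I"
    and XG: "\<And>t. t \<in> I \<Longrightarrow> X t \<in> G"
    and XhG: "\<And>t. t \<in> I \<Longrightarrow> Xh t \<in> G"
    and X: "\<And>t. t \<in> I \<Longrightarrow>
      (X has_vector_derivative (f (u t) (X t) + X t ** hat (w t))) (at t within I)"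
    and Xh: "\<And>t. t \<in> I \<Longrightarrow> (Xh has_vector_derivative f (u t) (Xh t)) (at t within I)"
    and \<eta>L: "\<And>t. t \<in> I \<Longrightarrow> \<eta>L t = matrix_inv (Xh t) ** X t"
    and \<eta>R: "\<And>t. t \<in> I \<Longrightarrow> \<eta>R t = X t ** matrix_inv (Xh t)"
    and \<xi>L: "\<And>t. t \<in> I \<Longrightarrow> \<xi>L t = logm (\<eta>L t)"
    and \<xi>R: "\<And>t. t \<in> I \<Longrightarrow> \<xi>R t = logm (\<eta>R t)"
  shows "(\<forall>t\<in>I. (\<eta>L has_vector_derivative
            (f (u t) (\<eta>L t) - f (u t) (mat 1) ** \<eta>L t + \<eta>L t ** hat (w t))) (at t within I))
    \<and> (\<forall>t\<in>I. (\<eta>R has_vector_derivative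
            (f (u t) (\<eta>R t) - \<eta>R t ** f (u t) (mat 1) + \<eta>R t ** Ad (Xh t) (hat (w t))))
            (at t within I))
    \<and> ((\<forall>t\<in>I. \<eta>L t \<in> V) \<and> (\<forall>t\<in>I. invertible (dexpm hat (- \<xi>L t))) \<and>
        (\<forall>t\<in>I. is_error_differential hat (\<lambda>\<eta>. f (u t) \<eta> - f (u t) (mat 1) ** \<eta>) (AL t))
        \<longrightarrow> (\<forall>t\<in>I. (\<xi>L has_vector_derivative
              (matrix_inv (dexpm hat (- \<xi>L t)) *v w t + AL t *v \<xi>L t)) (at t within I)))
    \<and> ((\<forall>t\<in>I. \<eta>R t \<in> V) \<and> (\<forall>t\<in>I. invertible (dexpm hat (- \<xi>R t))) \<and>
        (\<forall>t\<in>I. is_error_differential hat (\<lambda>\<eta>. f (u t) \<eta> - \<eta> ** f (u t) (mat 1)) (AR t))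
        \<longrightarrow> (\<forall>t\<in>I. (\<xi>R has_vector_derivative
              (matrix_inv (dexpm hat (- \<xi>R t)) *v Ad_vec hat (Xh t) (w t) + AR t *v \<xi>R t))
              (at t within I)))"
proof -
  interpret lie_group_chart G V hat logm
    using G hat logm by unfold_locales
  have f_tangent: "f (u t) Y \<in> tangent_space G Y" if "t \<in> I" "Y \<in> G" for t Y
    using f u that unfolding affine_group_system_def by blast
  have f_mult: "f (u t) (Y ** Z) = f (u t) Y ** Z + Y ** f (u t) Z - Y ** f (u t) (mat 1) ** Z"
    if "t \<in> I" "Y \<in> G" "Z \<in> G" for t Y Z
    using f u that unfolding affine_group_system_def by blast
  have Xh_inv: "((\<lambda>s. matrix_inv (Xh s)) has_vector_derivative
      - (matrix_inv (Xh t) ** f (u t) (Xh t) ** matrix_inv (Xh t))) (at t within I)" if "t \<in> I" for t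
    using Xh[OF that] that XhG invertible_in by (intro has_vector_derivative_matrix_inv) auto
  have \<eta>LG: "\<eta>L t \<in> G" and \<eta>RG: "\<eta>R t \<in> G" if "t \<in> I" for t
    using \<eta>L \<eta>R XG XhG that by simp_all
  have left: "(\<eta>L has_vector_derivative
      (f (u t) (\<eta>L t) - f (u t) (mat 1) ** \<eta>L t + \<eta>L t ** hat (w t))) (at t within I)"
    if t: "t \<in> I" for t
  proof -
    let ?Z = "matrix_inv (Xh t)"
    \<comment> \<open>The affine identity is applied to this product; its term with
      \<open>f (u t) (Xh t)\<close> cancels the one from differentiating the inverse of
      \<open>Xh\<close>.\<close>
    have X_eq: "X t = Xh t ** \<eta>L t"
      using XhG[OF t] by (simp add: \<eta>L[OF t] matrix_mul_assoc)
    have "?Z ** f (u t) (X t) = ?Z ** f (u t) (Xh t) ** \<eta>L t + f (u t) (\<eta>L t) - f (u t) (mat 1) ** \<eta>L t"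
      unfolding X_eq f_mult[OF t XhG[OF t] \<eta>LG[OF t]]
      by (simp add: matmul.add_right matmul.diff_right matrix_mul_assoc XhG[OF t])
    moreover have "((\<lambda>s. matrix_inv (Xh s) ** X s) has_vector_derivative
        (?Z ** (f (u t) (X t) + X t ** hat (w t)) + - (?Z ** f (u t) (Xh t) ** ?Z) ** X t)) (at t within I)"
      by (rule matmul.has_vector_derivative[OF Xh_inv[OF t] X[OF t]])
    ultimately have deriv: "((\<lambda>s. matrix_inv (Xh s) ** X s) has_vector_derivative
        (f (u t) (\<eta>L t) - f (u t) (mat 1) ** \<eta>L t + \<eta>L t ** hat (w t))) (at t within I)"
      by (simp add: matmul.add_right matmul.minus_left \<eta>L[OF t] matrix_mul_assoc[symmetric] add_diff_eq diff_add_eq)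
    show ?thesis by (rule has_vector_derivative_transform[OF t \<eta>L deriv])
  qed
  have right: "(\<eta>R has_vector_derivative
      (f (u t) (\<eta>R t) - \<eta>R t ** f (u t) (mat 1) + \<eta>R t ** Ad (Xh t) (hat (w t)))) (at t within I)"
    if t: "t \<in> I" for t
  proof -
    let ?Z = "matrix_inv (Xh t)"
    have X_eq: "X t = \<eta>R t ** Xh t"
      using XhG[OF t] by (simp add: \<eta>R[OF t] matrix_mul_assoc[symmetric])
    have "f (u t) (X t) ** ?Z = f (u t) (\<eta>R t) + \<eta>R t ** f (u t) (Xh t) ** ?Z - \<eta>R t ** f (u t) (mat 1)"
      unfolding X_eq f_mult[OF t \<eta>RG[OF t] XhG[OF t]]
      by (simp add: matmul.add_left matmul.diff_left matrix_mul_assoc[symmetric] XhG[OF t])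
    \<comment> \<open>Passing the disturbance through \<open>Xh\<close> to the right of the error is
      what creates the adjoint action.\<close>
    moreover have "X t ** hat (w t) ** ?Z = \<eta>R t ** Ad (Xh t) (hat (w t))"
      by (simp add: X_eq Ad_def matrix_mul_assoc)
    moreover have "((\<lambda>s. X s ** matrix_inv (Xh s)) has_vector_derivative
        (X t ** - (?Z ** f (u t) (Xh t) ** ?Z) + (f (u t) (X t) + X t ** hat (w t)) ** ?Z)) (at t within I)"
      by (rule matmul.has_vector_derivative[OF X[OF t] Xh_inv[OF t]])
    ultimately have deriv: "((\<lambda>s. X s ** matrix_inv (Xh s)) has_vector_derivative
        (f (u t) (\<eta>R t) - \<eta>R t ** f (u t) (mat 1) + \<eta>R t ** Ad (Xh t) (hat (w t)))) (at t within I)"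
      by (simp add: matmul.add_left matmul.minus_right \<eta>R[OF t] matrix_mul_assoc add_diff_eq diff_add_eq)
    show ?thesis by (rule has_vector_derivative_transform[OF t \<eta>R deriv])
  qed
  \<comment> \<open>The corrections subtracted from \<open>f\<close> on either side of \<eta> absorb
    the term Y f(I) Z of the affine identity, leaving a Leibniz rule.\<close>
  have gL: "(\<lambda>\<eta>. f (u t) \<eta> - f (u t) (mat 1) ** \<eta>) (Y ** Z) =
      (\<lambda>\<eta>. f (u t) \<eta> - f (u t) (mat 1) ** \<eta>) Y ** Z + Y ** (\<lambda>\<eta>. f (u t) \<eta> - f (u t) (mat 1) ** \<eta>) Z"
    and gR: "(\<lambda>\<eta>. f (u t) \<eta> - \<eta> ** f (u t) (mat 1)) (Y ** Z) =
      (\<lambda>\<eta>. f (u t) \<eta> - \<eta> ** f (u t) (mat 1)) Y ** Z + Y ** (\<lambda>\<eta>. f (u t) \<eta> - \<eta> ** f (u t) (mat 1)) Z"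
    if "t \<in> I" "Y \<in> G" "Z \<in> G" for t Y Z
    using f_mult[OF that] by (simp_all add: matmul.diff_left matmul.diff_right matrix_mul_assoc)
  \<comment> \<open>f(I) is in the Lie algebra, so its translates by \<open>Y\<close> on either side
    are tangent at \<open>Y\<close>, as is f(Y).\<close>
  have gL_tangent: "matrix_inv Y ** (f (u t) Y - f (u t) (mat 1) ** Y) \<in> lie_algebra G"
    and gR_tangent: "matrix_inv Y ** (f (u t) Y - Y ** f (u t) (mat 1)) \<in> lie_algebra G"
    if t: "t \<in> I" and Y: "Y \<in> G" for t Y
    using tangent_to_lie_algebra[OF f_tangent[OF t Y] Y]
      tangent_to_lie_algebra[OF tangent_mult_right[OF f_tangent[OF t one_in] Y]]
      tangent_to_lie_algebra[OF tangent_mult_left[OF f_tangent[OF t one_in] Y]] Y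
    by (simp_all add: matmul.diff_right lie_algebra_diff)
  show ?thesis
  proof (intro conjI ballI impI left right)
    fix t assume t: "t \<in> I" and *: "(\<forall>t\<in>I. \<eta>L t \<in> V) \<and> (\<forall>t\<in>I. invertible (dexpm hat (- \<xi>L t))) \<and>
        (\<forall>t\<in>I. is_error_differential hat (\<lambda>\<eta>. f (u t) \<eta> - f (u t) (mat 1) ** \<eta>) (AL t))"
    show "(\<xi>L has_vector_derivative
        (matrix_inv (dexpm hat (- \<xi>L t)) *v w t + AL t *v \<xi>L t)) (at t within I)"
      using * t
      by (intro log_error_derivative[OF t _ left[OF t] gL[OF t] gL_tangent[OF t] _ \<xi>L]) auto
  next
    fix t assume t: "t \<in> I" and *: "(\<forall>t\<in>I. \<eta>R t \<in> V) \<and> (\<forall>t\<in>I. invertible (dexpm hat (- \<xi>R t))) \<and>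
        (\<forall>t\<in>I. is_error_differential hat (\<lambda>\<eta>. f (u t) \<eta> - \<eta> ** f (u t) (mat 1)) (AR t))"
    show "(\<xi>R has_vector_derivative
        (matrix_inv (dexpm hat (- \<xi>R t)) *v Ad_vec hat (Xh t) (w t) + AR t *v \<xi>R t)) (at t within I)"
      using * t
      by (intro log_error_derivative[OF t _ right[OF t, folded hat_Ad_vec[OF XhG[OF t]]] gR[OF t]
            gR_tangent[OF t] _ \<xi>R]) auto
  qed
qed

end
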